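(* Let $\Gamma=(K,A,S,q,g)$ be a blind MDP, let $p_1\in\Delta(K)$ be an initial belief and let $\varepsilon>0$. Then there exists a strategy that is $\varepsilon$-optimal in $\Gamma(p_1)$ and eventually periodic (and thus has finite recall).
   Context: For a finite set $C$, $\Delta(C)$ denotes the set of probability distributions on $C$. A POMDP $\Gamma=(K,A,S,q,g)$ consists of a finite state space $K$, a finite action set $A$, a finite signal set $S$, a transition function $q:K\times A\to\Delta(K\times S)$ and a reward function $g:K\times A\to[0,1]$. Given an initial belief $p_1\in\Delta(K)$, the process $\Gamma(p_1)$ runs as follows: an initial state $k_1$ is drawn from $p_1$ (the decision-maker knows $p_1$ but not $k_1$); at each stage $m\ge1$ the decision-maker chooses an action $a_m\in A$, receives (without observing it) the stage reward $g_m:=g(k_m,a_m)$, then a pair $(k_{m+1},s_m)$ is drawn from $q(k_m,a_m)$; the decision-maker observes only the signal $s_m$. Let $H_m:=(A\times S)^{m-1}$ be the set of histories before stage $m$. A strategy is a map $\sigma:\bigcup_{m\ge1}H_m\to A$; $\Sigma$ is the set of strategies. $\mathbb{P}^{p_1}_\sigma$ denotes the law on plays induced by $p_1$ and $\sigma$, $\mathbb{E}^{p_1}_\sigma$ its expectation. The long-run payoff is $\gamma^{p_1}_\infty(\sigma):=\mathbb{E}^{p_1}_\sigma\left(\liminf_{n\to\infty}\frac1n\sum_{m=1}^n g_m\right)$, and the value is $v_\infty(p_1):=\sup_{\sigma\in\Sigma}\gamma^{p_1}_\infty(\sigma)$. A strategy is $\varepsilon$-optimal in $\Gamma(p_1)$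 if $\gamma^{p_1}_\infty(\sigma)\ge v_\infty(p_1)-\varepsilon$. A blind MDP is a POMDP whose signal set $S$ is a singleton; then a strategy is just an infinite sequence of actions $(a_1,a_2,\dots)\in A^{\mathbb{N}}$. Such a strategy is eventually periodic if there exist integers $T\ge1$ and $N\ge1$ with $a_{m+T}=a_m$ for all $m\ge N$. A strategy has finite recall if there exists $M>0$ such that for all $m>M$ and $h_M\in H_M$, the value $\sigma(h_{m-M},h_M)$ does not depend on $h_{m-M}\in H_{m-M}$. *)

theory Defs
  imports "HOL-Probability.Probability"
begin

text \<open>A POMDP with finite types of states 'k, actions 'a and signals 's:
  transition q k a is a distribution on 'k \<times> 's, reward g k a.
  A blind MDP is one where the signal type is a singleton; then a strategy is
  an action sequence \<sigma> :: nat \<Rightarrow> 'a (stage m+1 of the paper is index m).\<close>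

definition blind_MDP :: "('k::finite \<Rightarrow> 'a::finite \<Rightarrow> ('k \<times> 's::finite) pmf) \<Rightarrow> ('k \<Rightarrow> 'a \<Rightarrow> real) \<Rightarrow> bool" where
  "blind_MDP q g \<longleftrightarrow> CARD('s) = 1 \<and> (\<forall>k a. 0 \<le> g k a \<and> g k a \<le> 1)"

definition cyl_prob :: "'k pmf \<Rightarrow> ('k \<Rightarrow> 'a \<Rightarrow> ('k \<times> 's) pmf) \<Rightarrow> (nat \<Rightarrow> 'a) \<Rightarrow> nat \<Rightarrow> (nat \<Rightarrow> 'k) \<Rightarrow> real" where
  "cyl_prob p1 q \<sigma> n ks =
     pmf p1 (ks 0) * (\<Prod>i<n. pmf (map_pmf fst (q (ks i) (\<sigma> i))) (ks (Suc i)))"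

definition play_law :: "'k pmf \<Rightarrow> ('k \<Rightarrow> 'a \<Rightarrow> ('k \<times> 's) pmf) \<Rightarrow> (nat \<Rightarrow> 'a) \<Rightarrow> (nat \<Rightarrow> 'k) measure" where
  "play_law p1 q \<sigma> = (THE M. prob_space M \<and> sets M = sets (PiM UNIV (\<lambda>_. count_space UNIV)) \<and>
      (\<forall>n ks. emeasure M {\<omega> \<in> space M. \<forall>i\<le>n. \<omega> i = ks i} = ennreal (cyl_prob p1 q \<sigma> n ks)))"

definition payoff_inf :: "'k pmf \<Rightarrow> ('k \<Rightarrow> 'a \<Rightarrow> ('k \<times> 's) pmf) \<Rightarrow> ('k \<Rightarrow> 'a \<Rightarrow> real) \<Rightarrow> (nat \<Rightarrow> 'a) \<Rightarrow> real" where
  "payoff_inf p1 q g \<sigma> = integral\<^sup>L (play_law p1 q \<sigma>)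
     (\<lambda>\<omega>. real_of_ereal (liminf (\<lambda>n. ereal ((\<Sum>m<n. g (\<omega> m) (\<sigma> m)) / real n))))"

definition value_inf :: "'k pmf \<Rightarrow> ('k \<Rightarrow> 'a \<Rightarrow> ('k \<times> 's) pmf) \<Rightarrow> ('k \<Rightarrow> 'a \<Rightarrow> real) \<Rightarrow> real" where
  "value_inf p1 q g = (SUP \<sigma>. payoff_inf p1 q g \<sigma>)"

definition eventually_periodic :: "(nat \<Rightarrow> 'a) \<Rightarrow> bool" where
  "eventually_periodic \<sigma> \<longleftrightarrow> (\<exists>T N. T \<ge> 1 \<and> (\<forall>m\<ge>N. \<sigma> (m + T) = \<sigma> m))"

end

theory Submission
  imports Defs
begin

text \<open>Let \<open>\<sigma>\<close> be a nearly optimal action sequence. For a window length \<open>n\<close> let \<open>\<phi>\<^sub>n(m, k)\<close> be the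
  expected average reward of \<open>\<sigma>\<close> over the stages \<open>m, \<dots>, m + n - 1\<close> given state \<open>k\<close> at stage \<open>m\<close>.
  Averaging over \<open>m < N\<close>, the second moment of \<open>\<phi>\<^sub>n\<close> telescopes, while
  the conditional mean of \<open>\<phi>\<^sub>n(m + l, k\<^bsub>m+l\<^esub>)\<close> given \<open>k\<^sub>m = k\<close> differs from \<open>\<phi>\<^sub>n(m, k)\<close> by at most
  \<open>l / n\<close>. Hence for \<open>l\<close> much smaller than \<open>n\<close>, at most stages \<open>m\<close> and for most states \<open>k\<close>,
  every state \<open>j\<close> reachable from \<open>k\<close> within \<open>l\<close> steps has \<open>\<phi>\<^sub>n(m + l, j) \<ge> \<phi>\<^sub>n(m, k) - \<epsilon>\<close>.

  Apply this on a rapidly growing sequence of scales. The map sending \<open>k\<close> to the set of states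
  reachable from it takes finitely many values, so between two consecutive scales it can be brought
  back to its earlier value by a word of bounded length. Repeating forever the long
  window followed by this return word keeps every reachable set invariant, so nothing leaks
  out of it. Each such block, from any state of the set, earns nearly the initial average, and
  a law of large numbers turns this into an almost sure lower bound.\<close>

section \<open>The law of an inhomogeneous finite Markov chain\<close>

lemma singleton_in_sets_PiM_count_space:
  assumes "finite J"
  shows "{restrict ks J} \<in> sets (PiM J (\<lambda>_. count_space (UNIV :: 'k set)))"
proof -
  have "PiE J (\<lambda>i. {ks i}) = {restrict ks J}"
    by (auto simp: PiE_def extensional_def restrict_def fun_eq_iff)
  moreover have "PiE J (\<lambda>i. {ks i}) \<in> sets (PiM J (\<lambda>_. count_space (UNIV :: 'k set)))"
    by (rule sets_PiM_I_finite) (auto simp: assms)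
  ultimately show ?thesis by simp
qed

text \<open>The formula of \<open>cyl_prob\<close> with actions and signals abstracted into one
  stage-dependent transition kernel \<open>Q\<close>.\<close>

definition path_prob :: "'k pmf \<Rightarrow> (nat \<Rightarrow> 'k \<Rightarrow> 'k pmf) \<Rightarrow> nat \<Rightarrow> (nat \<Rightarrow> 'k) \<Rightarrow> real" where
  "path_prob p Q n ks = pmf p (ks 0) * (\<Prod>i<n. pmf (Q i (ks i)) (ks (Suc i)))"

text \<open>Ionescu-Tulcea applied to kernels that read only the last coordinate of the past.
  Cylinder probabilities then follow by induction on the number of coordinates.\<close>

lemma markov_chain_exists:
  fixes p :: "'k pmf" and Q :: "nat \<Rightarrow> 'k \<Rightarrow> 'k pmf"
  shows "\<exists>M. prob_space M \<and> sets M = sets (PiM UNIV (\<lambda>_. count_space UNIV)) \<and>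
      (\<forall>n ks. emeasure M {\<omega> \<in> space M. \<forall>i\<le>n. \<omega> i = ks i} = ennreal (path_prob p Q n ks))"
proof -
  define K where "K i \<omega> = (case i of 0 \<Rightarrow> measure_pmf p | Suc j \<Rightarrow> measure_pmf (Q j (\<omega> j)))"
    for i and \<omega> :: "nat \<Rightarrow> 'k"
  interpret Ionescu_Tulcea K "\<lambda>_. count_space UNIV"
  proof (rule Ionescu_Tulcea.intro)
    fix i
    show "K i \<in> measurable (PiM {0..<i} (\<lambda>_. count_space UNIV)) (subprob_algebra (count_space UNIV))"
    proof (cases i)
      case 0
      then show ?thesis
        by (auto simp: K_def[abs_def] space_subprob_algebra measure_pmf.subprob_space_axioms)
    next
      case (Suc j)
      have "(\<lambda>\<omega>. \<omega> j) \<in> measurable (PiM {0..<i} (\<lambda>_. count_space (UNIV :: 'k set))) (count_space UNIV)"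
        by (rule measurable_component_singleton) (simp add: Suc)
      from measurable_compose[OF this measurable_measure_pmf[of "Q j"]] show ?thesis
        by (simp add: K_def[abs_def] Suc)
    qed
  next
    show "prob_space (K i x)" for i x
      unfolding K_def by (cases i) (auto simp: measure_pmf.prob_space_axioms)
  qed
  \<comment> \<open>\<open>u\<close> is the only point of the product over the empty index set, that
    is, the empty past from which the construction starts.\<close>
  define u where "u = (\<lambda>_::nat. undefined :: 'k)"
  have sp: "u \<in> space (PiM {0..<0} (\<lambda>_. count_space UNIV))"
    by (simp add: u_def space_PiM)
  \<comment> \<open>\<open>C 0 n u\<close> is the law of the \<open>n\<close> coordinates below
    \<open>n\<close>, whereas \<open>path_prob p Q n\<close> involves coordinates \<open>0\<close>
    to \<open>n\<close>; hence the shift by one and the separate value at \<open>0\<close>.\<close>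
  define pp where "pp n ks = (if n = 0 then 1 else path_prob p Q (n - 1) ks)" for n ks
  have C: "emeasure (C 0 n u) {restrict ks {0..<n}} = ennreal (pp n ks)" for n ks
  proof (induction n)
    case 0
    show ?case by (simp add: pp_def u_def restrict_def PiM_empty)
  next
    case (Suc n)
    let ?N = "PiM {0..<n} (\<lambda>_. count_space (UNIV::'k set))"
    have A: "{restrict ks {0..<Suc n}} \<in> sets (PiM {0..<Suc n} (\<lambda>_. count_space UNIV))"
      by (rule singleton_in_sets_PiM_count_space) simp
    have B: "{restrict ks {0..<n}} \<in> sets ?N"
      by (rule singleton_in_sets_PiM_count_space) simp
    define c where "c = (if n = 0 then pmf p (ks 0) else pmf (Q (n - 1) (ks (n - 1))) (ks n))"
    have ne: "space (C 0 n u) \<noteq> {}"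
      using space_C[OF sp, of n] by simp
    have "emeasure (C 0 (Suc n) u) {restrict ks {0..<Suc n}}
        = (\<integral>\<^sup>+ x. emeasure (eP n x) {restrict ks {0..<Suc n}} \<partial>C 0 n u)"
      using ne sets_C[OF sp, of n] measurable_eP[of n]
      by (simp, subst emeasure_bind[OF _ _ A])
        (auto simp: measurable_cong_sets[OF sets_C[OF sp, of n] refl])
    also have "\<dots> = (\<integral>\<^sup>+ x. ennreal c * indicator {restrict ks {0..<n}} x \<partial>C 0 n u)"
    proof (rule nn_integral_cong)
      fix x assume "x \<in> space (C 0 n u)"
      then have x: "x \<in> space ?N" using space_C[OF sp, of n] by simp
      then have xe: "x \<in> extensional {0..<n}" by (simp add: space_PiM PiE_def)
      \<comment> \<open>\<open>eP n x\<close> is the image of \<open>K n x\<close> under appending a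
        coordinate, so a prescribed path has a one-point preimage if \<open>x\<close> is its initial
        part and an empty one otherwise.\<close>
      have e: "(\<lambda>y. x(n := y)) -` {restrict ks {0..<Suc n}} = (if x = restrict ks {0..<n} then {ks n} else {})"
      proof -
        have "x(n := y) = restrict ks {0..<Suc n} \<longleftrightarrow> x = restrict ks {0..<n} \<and> y = ks n" for y
        proof safe
          assume h: "x(n := y) = restrict ks {0..<Suc n}"
          show "x = restrict ks {0..<n}"
          proof
            fix i show "x i = restrict ks {0..<n} i"
              using fun_cong[OF h, of i] xe by (auto simp: extensional_def restrict_def split: if_splits)
          qed
          show "y = ks n" using fun_cong[OF h, of n] by simp
        qed (auto simp: restrict_def fun_eq_iff)
        then show ?thesis unfolding vimage_def by (cases "x = restrict ks {0..<n}") simp_all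
      qed
      have k: "emeasure (K n (restrict ks {0..<n})) {ks n} = ennreal c"
        by (cases n) (simp_all add: K_def c_def emeasure_pmf_single)
      show "emeasure (eP n x) {restrict ks {0..<Suc n}} = ennreal c * indicator {restrict ks {0..<n}} x"
        unfolding emeasure_eP[OF x A]
        unfolding e using k by (cases "x = restrict ks {0..<n}") simp_all
    qed
    also have "\<dots> = ennreal c * ennreal (pp n ks)"
      unfolding Suc[symmetric] by (rule nn_integral_cmult_indicator) (use B sets_C[OF sp, of n] in simp)
    also have "\<dots> = ennreal (pp (Suc n) ks)"
      by (cases n) (auto simp: c_def pp_def path_prob_def ennreal_mult[symmetric] prod_nonneg ac_simps
          lessThan_Suc)
    finally show ?case .
  qed
  show ?thesis
  proof (intro exI[of _ PF.lim] conjI allI)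
    show "sets PF.lim = sets (PiM UNIV (\<lambda>_. count_space UNIV))" by simp
    show "prob_space PF.lim"
    proof
      \<comment> \<open>The whole space is the cylinder over the empty index set, which reduces the
        total mass to that of \<open>C 0 0 u\<close>.\<close>
      have "emeasure PF.lim (PF.emb UNIV {} {u}) = emeasure (CI {}) {u}"
        by (rule lim) (auto simp: u_def PiM_empty)
      also have "\<dots> = emeasure (C 0 0 u) (PF.emb {0..<0} {} {u})"
        unfolding u_def by (rule emeasure_CI) (auto simp: u_def PiM_empty)
      also have "\<dots> = 1" by (simp add: u_def PiM_empty prod_emb_def)
      also have "PF.emb UNIV {} {u} = space PF.lim"
        by (auto simp: prod_emb_def u_def space_PiM)
      finally show "emeasure PF.lim (space PF.lim) = 1" .
    qed
    fix n and ks :: "nat \<Rightarrow> 'k"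
    have B: "{restrict ks {0..<Suc n}} \<in> sets (PiM {0..<Suc n} (\<lambda>_. count_space UNIV))"
      by (rule singleton_in_sets_PiM_count_space) simp
    have "{\<omega> \<in> space PF.lim. \<forall>i\<le>n. \<omega> i = ks i} = PF.emb UNIV {0..<Suc n} {restrict ks {0..<Suc n}}"
      by (auto simp: prod_emb_def space_PiM fun_eq_iff restrict_def split: if_splits)
    also have "emeasure PF.lim \<dots> = emeasure (CI {0..<Suc n}) {restrict ks {0..<Suc n}}"
      by (rule lim[OF _ B]) simp
    also have "\<dots> = emeasure (C 0 (Suc n) u) (PF.emb {0..<Suc n} {0..<Suc n} {restrict ks {0..<Suc n}})"
      unfolding u_def by (rule emeasure_CI[OF _ B]) simp
    also have "\<dots> = ennreal (path_prob p Q n ks)"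
      using C[of "Suc n" ks] B by (simp add: pp_def prod_emb_id sets.sets_into_space del: C.simps)
    finally show "emeasure PF.lim {\<omega> \<in> space PF.lim. \<forall>i\<le>n. \<omega> i = ks i} = ennreal (path_prob p Q n ks)" .
  qed
qed

section \<open>Functionals of finitely many coordinates and the Markov property\<close>

definition depends_upto :: "nat \<Rightarrow> ((nat \<Rightarrow> 'k) \<Rightarrow> 'b) \<Rightarrow> bool" where
  "depends_upto n F \<longleftrightarrow> (\<forall>\<omega> \<omega>'. (\<forall>i\<le>n. \<omega> i = \<omega>' i) \<longrightarrow> F \<omega> = F \<omega>')"

lemma depends_uptoD: "depends_upto n F \<Longrightarrow> (\<And>i. i \<le> n \<Longrightarrow> \<omega> i = \<omega>' i) \<Longrightarrow> F \<omega> = F \<omega>'"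
  unfolding depends_upto_def by blast

locale markov_chain = prob_space M
  for M :: "(nat \<Rightarrow> 'k::finite) measure" +
  fixes p :: "'k pmf" and Q :: "nat \<Rightarrow> 'k \<Rightarrow> 'k pmf"
  assumes sets_M: "sets M = sets (PiM UNIV (\<lambda>_. count_space UNIV))"
    and cylinder: "emeasure M {\<omega> \<in> space M. \<forall>i\<le>n. \<omega> i = ks i} = ennreal (path_prob p Q n ks)"
begin

lemma space_M [simp]: "space M = UNIV"
  using sets_eq_imp_space_eq[OF sets_M] by (simp add: space_PiM)

lemma coordinate_measurable [measurable]: "(\<lambda>\<omega>. \<omega> i) \<in> measurable M (count_space UNIV)"
  unfolding measurable_cong_sets[OF sets_M refl] by (rule measurable_component_singleton) simp

lemma cylinder_sets: "{\<omega>. \<forall>i\<le>n. \<omega> i = ks i} \<in> sets M"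
proof -
  have "{\<omega> \<in> space M. \<forall>i\<le>n. \<omega> i = ks i} \<in> sets M" by measurable
  then show ?thesis by simp
qed

lemma measure_cylinder: "measure M {\<omega>. \<forall>i\<le>n. \<omega> i = ks i} = path_prob p Q n ks"
  using cylinder[of n ks] by (simp add: measure_def path_prob_def prod_nonneg)

text \<open>Since the state space is finite, such an \<open>F\<close> is a finite combination of
  cylinder indicators, so its integral becomes a finite sum. Extensional functions on
  \<open>{..n}\<close> serve as unique representatives of the cylinders.\<close>

lemma finite_dim_expand:
  fixes F :: "(nat \<Rightarrow> 'k) \<Rightarrow> real"
  assumes "depends_upto n F"
  shows "F \<omega> = (\<Sum>ks\<in>PiE {..n} (\<lambda>_. UNIV). F ks * indicator {\<omega>. \<forall>i\<le>n. \<omega> i = ks i} \<omega>)"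
proof -
  let ?k = "restrict \<omega> {..n}"
  have "(\<Sum>ks\<in>PiE {..n} (\<lambda>_. UNIV). F ks * indicator {\<omega>. \<forall>i\<le>n. \<omega> i = ks i} \<omega>)
      = (\<Sum>ks\<in>PiE {..n} (\<lambda>_. UNIV). if ks = ?k then F ?k else 0)"
  proof (rule sum.cong[OF refl])
    fix ks assume ks: "ks \<in> PiE {..n} (\<lambda>_. UNIV :: 'k set)"
    have "(\<forall>i\<le>n. \<omega> i = ks i) \<longleftrightarrow> ks = ?k"
      using ks by (auto simp: fun_eq_iff PiE_def extensional_def restrict_def)
    then show "F ks * indicator {\<omega>. \<forall>i\<le>n. \<omega> i = ks i} \<omega> = (if ks = ?k then F ?k else 0)"
      by (auto simp: indicator_def)
  qed
  also have "\<dots> = F ?k" by (simp add: finite_PiE)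
  also have "\<dots> = F \<omega>" by (rule depends_uptoD[OF assms]) simp
  finally show ?thesis by simp
qed

lemma
  fixes F :: "(nat \<Rightarrow> 'k) \<Rightarrow> real"
  assumes "depends_upto n F"
  shows finite_dim_integrable: "integrable M F"
    and finite_dim_integral: "(\<integral>\<omega>. F \<omega> \<partial>M) = (\<Sum>ks\<in>PiE {..n} (\<lambda>_. UNIV). F ks * path_prob p Q n ks)"
proof -
  let ?G = "\<lambda>\<omega>. \<Sum>ks\<in>PiE {..n} (\<lambda>_. UNIV). F ks * indicator {\<omega>. \<forall>i\<le>n. \<omega> i = ks i} \<omega>"
  have FG: "F = ?G" using finite_dim_expand[OF assms] by blast
  have i: "integrable M (\<lambda>\<omega>. F ks * indicator {\<omega>. \<forall>i\<le>n. \<omega> i = ks i} \<omega>)" for ks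
    using cylinder_sets[of n ks] by (simp add: emeasure_eq_measure)
  have "integrable M ?G" by (rule Bochner_Integration.integrable_sum) (rule i)
  then show "integrable M F" using FG by simp
  have "(\<integral>\<omega>. F \<omega> \<partial>M) = (\<integral>\<omega>. ?G \<omega> \<partial>M)" using FG by simp
  also have "\<dots> = (\<Sum>ks\<in>PiE {..n} (\<lambda>_. UNIV). F ks * path_prob p Q n ks)"
    by (subst Bochner_Integration.integral_sum[OF i]) (simp add: measure_cylinder cylinder_sets)
  finally show "(\<integral>\<omega>. F \<omega> \<partial>M) = (\<Sum>ks\<in>PiE {..n} (\<lambda>_. UNIV). F ks * path_prob p Q n ks)" .
qed

text \<open>A rearrangement of finite sums: splitting off coordinate \<open>Suc n\<close> factors
  one transition probability out of \<open>path_prob\<close>. \<open>H\<close> sees both the old and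
  the new state so that increments attached to a transition can be averaged.\<close>

lemma markov_property:
  fixes F :: "(nat \<Rightarrow> 'k) \<Rightarrow> real" and H :: "'k \<Rightarrow> 'k \<Rightarrow> real"
  assumes F: "depends_upto n F"
  shows "(\<integral>\<omega>. F \<omega> * H (\<omega> n) (\<omega> (Suc n)) \<partial>M)
    = (\<integral>\<omega>. F \<omega> * (\<Sum>j\<in>UNIV. pmf (Q n (\<omega> n)) j * H (\<omega> n) j) \<partial>M)"
proof -
  let ?E = "PiE {..n} (\<lambda>_. UNIV :: 'k set)"
  have d1: "depends_upto (Suc n) (\<lambda>\<omega>. F \<omega> * H (\<omega> n) (\<omega> (Suc n)))"
    using F by (simp add: depends_upto_def)
  have d2: "depends_upto n (\<lambda>\<omega>. F \<omega> * (\<Sum>j\<in>UNIV. pmf (Q n (\<omega> n)) j * H (\<omega> n) j))"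
    using F by (simp add: depends_upto_def)
  have upd: "F (ks(Suc n := j)) = F ks" for ks j
    by (rule depends_uptoD[OF F]) simp
  have pp: "path_prob p Q (Suc n) (ks(Suc n := j)) = path_prob p Q n ks * pmf (Q n (ks n)) j" for ks j
    by (simp add: path_prob_def lessThan_Suc ac_simps)
  have "(\<integral>\<omega>. F \<omega> * H (\<omega> n) (\<omega> (Suc n)) \<partial>M)
      = (\<Sum>ks\<in>PiE (insert (Suc n) {..n}) (\<lambda>_. UNIV). F ks * H (ks n) (ks (Suc n)) * path_prob p Q (Suc n) ks)"
    unfolding finite_dim_integral[OF d1] atMost_Suc ..
  also have "\<dots> = (\<Sum>(j, ks)\<in>UNIV \<times> ?E. F ks * H (ks n) j * (path_prob p Q n ks * pmf (Q n (ks n)) j))"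
    unfolding PiE_insert_eq
    by (subst sum.reindex[OF inj_combinator]) (auto simp: upd pp intro!: sum.cong)
  also have "\<dots> = (\<Sum>ks\<in>?E. \<Sum>j\<in>UNIV. F ks * H (ks n) j * (path_prob p Q n ks * pmf (Q n (ks n)) j))"
    by (subst sum.swap) (simp add: sum.cartesian_product)
  also have "\<dots> = (\<Sum>ks\<in>?E. F ks * (\<Sum>j\<in>UNIV. pmf (Q n (ks n)) j * H (ks n) j) * path_prob p Q n ks)"
    by (intro sum.cong refl) (simp add: sum_distrib_left sum_distrib_right ac_simps)
  finally show ?thesis unfolding finite_dim_integral[OF d2] .
qed

end

text \<open>Measures on the infinite product agree once they agree on finite-dimensional boxes, and
  the indicator of a box depends only on coordinates up to the largest index involved. Inserting
  \<open>0\<close> in \<open>n\<close> covers an empty \<open>J\<close>.\<close>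

lemma markov_chain_unique:
  assumes "markov_chain M p Q" "markov_chain N p Q"
  shows "M = N"
proof -
  interpret M: markov_chain M p Q by fact
  interpret N: markov_chain N p Q by fact
  show ?thesis
  proof (rule measure_eqI_PiM_infinite[OF M.sets_M N.sets_M])
    show "finite_measure M" by (rule M.finite_measure_axioms)
    fix J :: "nat set" and A :: "nat \<Rightarrow> 'a set" assume J: "finite J"
    let ?S = "prod_emb UNIV (\<lambda>_. count_space UNIV) J (PiE J A)"
    define n where "n = Max (insert 0 J)"
    have d: "depends_upto n (indicator ?S :: _ \<Rightarrow> real)"
    proof -
      have "i \<le> n" if "i \<in> J" for i using that J by (simp add: n_def)
      then have "\<omega> \<in> ?S \<longleftrightarrow> \<omega>' \<in> ?S" if "\<forall>i\<le>n. \<omega> i = \<omega>' i" for \<omega> \<omega>'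
        using that by (auto simp: prod_emb_def PiE_iff)
      then show ?thesis unfolding depends_upto_def indicator_def by auto
    qed
    have S: "?S \<in> sets (PiM UNIV (\<lambda>_. count_space (UNIV :: 'a set)))"
      by (intro sets_PiM_I) (auto simp: J)
    have "measure M ?S = measure N ?S"
      using M.finite_dim_integral[OF d] N.finite_dim_integral[OF d] by simp
    then show "emeasure M ?S = emeasure N ?S"
      by (simp add: M.emeasure_eq_measure N.emeasure_eq_measure)
  qed
qed

text \<open>Existence and uniqueness make the description by \<open>THE\<close> in
  \<open>play_law\<close> meaningful; from here on only the chain properties are used.\<close>

lemma play_law_markov_chain:
  fixes q :: "'k::finite \<Rightarrow> 'a \<Rightarrow> ('k \<times> 's) pmf"
  shows "markov_chain (play_law p1 q \<sigma>) p1 (\<lambda>i k. map_pmf fst (q k (\<sigma> i)))"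
proof -
  let ?Q = "\<lambda>i k. map_pmf fst (q k (\<sigma> i))"
  have eq: "(prob_space M \<and> sets M = sets (PiM UNIV (\<lambda>_. count_space UNIV)) \<and>
      (\<forall>n ks. emeasure M {\<omega> \<in> space M. \<forall>i\<le>n. \<omega> i = ks i} = ennreal (cyl_prob p1 q \<sigma> n ks)))
    \<longleftrightarrow> markov_chain M p1 ?Q" for M
    by (auto simp: markov_chain_def markov_chain_axioms_def cyl_prob_def path_prob_def)
  have ex: "\<exists>M. markov_chain M p1 ?Q"
    using markov_chain_exists[of p1 ?Q] by (auto simp: markov_chain_def markov_chain_axioms_def)
  then have "\<exists>!M. markov_chain M p1 ?Q"
    using markov_chain_unique by blast
  then show ?thesis
    unfolding play_law_def eq by (rule theI')
qed

section \<open>A law of large numbers under a drift condition\<close>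

text \<open>The estimate behind the Chernoff argument below: a nonpositive mean leaves only the
  quadratic term.\<close>

lemma exp_le_quadratic:
  fixes x :: real
  assumes "\<bar>x\<bar> \<le> 1"
  shows "exp x \<le> 1 + x + x\<^sup>2"
proof (cases "0 \<le> x")
  case True
  then show ?thesis using exp_bound[of x] assms by simp
next
  case False
  define y where "y = - x"
  have y: "0 \<le> y" using False by (simp add: y_def)
  have "1 + y \<le> exp y" by simp
  then have "exp x \<le> 1 / (1 + y)"
    using y by (simp add: y_def exp_minus field_simps)
  also have "\<dots> \<le> 1 - y + y\<^sup>2"
  proof -
    have "(1 + y) * (1 - y + y\<^sup>2) = 1 + y ^ 3"
      by (simp add: algebra_simps power2_eq_square power3_eq_cube)
    then have "1 \<le> (1 + y) * (1 - y + y\<^sup>2)" using y by simp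
    then show ?thesis using y by (simp add: pos_divide_le_eq mult.commute)
  qed
  finally show ?thesis by (simp add: y_def)
qed

lemma expectation_pmf_finite:
  fixes p :: "'k::finite pmf" and f :: "'k \<Rightarrow> real"
  shows "measure_pmf.expectation p f = (\<Sum>k\<in>UNIV. pmf p k * f k)"
  by (subst integral_measure_pmf_real[of UNIV]) (auto simp: mult.commute)

lemma expectation_bind_pmf_finite:
  fixes p :: "'k::finite pmf" and Q :: "'k \<Rightarrow> 'k pmf" and f :: "'k \<Rightarrow> real"
  shows "measure_pmf.expectation (bind_pmf p Q) f
    = measure_pmf.expectation p (\<lambda>k. measure_pmf.expectation (Q k) f)"
  unfolding expectation_pmf_finite pmf_bind sum_distrib_right sum_distrib_left
  by (subst sum.swap) (simp add: ac_simps)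

section \<open>Laws of single states and almost sure estimates along paths\<close>

primrec belief :: "'k pmf \<Rightarrow> (nat \<Rightarrow> 'k \<Rightarrow> 'k pmf) \<Rightarrow> nat \<Rightarrow> 'k pmf" where
  "belief p Q 0 = p"
| "belief p Q (Suc n) = bind_pmf (belief p Q n) (Q n)"

context markov_chain
begin

lemma integral_coordinate:
  fixes h :: "'k \<Rightarrow> real"
  shows "(\<integral>\<omega>. h (\<omega> n) \<partial>M) = measure_pmf.expectation (belief p Q n) h"
proof (induction n arbitrary: h)
  case 0
  have d: "depends_upto 0 (\<lambda>\<omega>. h (\<omega> 0))" by (simp add: depends_upto_def)
  have e: "PiE {0::nat} (\<lambda>_. UNIV :: 'k set) = (\<lambda>k. restrict (\<lambda>_. k) {0}) ` UNIV"
    by (auto simp: PiE_def extensional_def fun_eq_iff image_def)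
  have inj: "inj (\<lambda>k. restrict (\<lambda>_. k) {0::nat} :: nat \<Rightarrow> 'k)"
    by (auto simp: inj_def fun_eq_iff restrict_def dest: spec[of _ 0])
  show ?case
    unfolding finite_dim_integral[OF d] expectation_pmf_finite
    by (simp add: e sum.reindex[OF inj] path_prob_def mult.commute)
next
  case (Suc n)
  have "(\<integral>\<omega>. h (\<omega> (Suc n)) \<partial>M) = (\<integral>\<omega>. measure_pmf.expectation (Q n (\<omega> n)) h \<partial>M)"
    using markov_property[of n "\<lambda>_. 1" "\<lambda>_. h"] by (simp add: depends_upto_def expectation_pmf_finite)
  also have "\<dots> = measure_pmf.expectation (belief p Q (Suc n)) h"
    by (simp add: Suc[of "\<lambda>k. measure_pmf.expectation (Q n k) h"] expectation_bind_pmf_finite)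
  finally show ?case .
qed

lemma coordinate_integrable:
  fixes h :: "'k \<Rightarrow> real"
  shows "integrable M (\<lambda>\<omega>. h (\<omega> n))"
  by (rule finite_dim_integrable[of n]) (simp add: depends_upto_def)

text \<open>By the Markov property the indicator of a forbidden transition at stage \<open>n\<close>
  has integral zero; there are countably many stages.\<close>

lemma AE_transition: "AE \<omega> in M. \<forall>n. \<omega> (Suc n) \<in> set_pmf (Q n (\<omega> n))"
proof (subst AE_all_countable, intro allI)
  fix n
  let ?H = "\<lambda>x y. if y \<in> set_pmf (Q n x) then 0 else 1 :: real"
  have "(\<integral>\<omega>. ?H (\<omega> n) (\<omega> (Suc n)) \<partial>M)
      = (\<integral>\<omega>. (\<Sum>j\<in>UNIV. pmf (Q n (\<omega> n)) j * ?H (\<omega> n) j) \<partial>M)"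
    using markov_property[of n "\<lambda>_. 1" ?H] by (simp add: depends_upto_def)
  also have "\<dots> = 0"
    by (auto intro!: integral_eq_zero_AE sum.neutral simp: set_pmf_iff)
  finally have "(\<integral>\<omega>. ?H (\<omega> n) (\<omega> (Suc n)) \<partial>M) = 0" .
  moreover have "integrable M (\<lambda>\<omega>. ?H (\<omega> n) (\<omega> (Suc n)))"
    by (rule finite_dim_integrable[of "Suc n"]) (simp add: depends_upto_def)
  ultimately have "AE \<omega> in M. ?H (\<omega> n) (\<omega> (Suc n)) = 0"
    by (subst (asm) integral_nonneg_eq_0_iff_AE) auto
  then show "AE \<omega> in M. \<omega> (Suc n) \<in> set_pmf (Q n (\<omega> n))"
    by eventually_elim (auto split: if_splits)
qed

text \<open>Conditionally on a state in \<open>A n\<close>, the mean of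
  \<open>exp (\<theta> * Z)\<close> is at most \<open>1 + (\<theta> * B)\<^sup>2\<close>, because
  the linear term is nonpositive there. Truncating to paths that stay in \<open>A\<close> is needed
  since the drift is controlled only on \<open>A\<close>.\<close>

lemma exponential_supermartingale:
  fixes Z :: "nat \<Rightarrow> 'k \<Rightarrow> 'k \<Rightarrow> real" and A :: "nat \<Rightarrow> 'k set"
  assumes bound: "\<And>n x y. \<bar>Z n x y\<bar> \<le> B"
    and mean: "\<And>n x. m \<le> n \<Longrightarrow> x \<in> A n \<Longrightarrow> measure_pmf.expectation (Q n x) (Z n x) \<le> 0"
    and \<theta>: "0 \<le> \<theta>" "\<theta> * B \<le> 1" and n: "m \<le> n"
  shows "(\<integral>\<omega>. (if \<forall>i\<in>{m..n}. \<omega> i \<in> A i then exp (\<theta> * (\<Sum>i=m..<n. Z i (\<omega> i) (\<omega> (Suc i)))) else 0) \<partial>M)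
    \<le> (1 + (\<theta> * B)\<^sup>2) ^ (n - m)"
  using n
proof (induction rule: dec_induct)
  let ?G = "\<lambda>n \<omega>. (if \<forall>i\<in>{m..n}. \<omega> i \<in> A i then exp (\<theta> * (\<Sum>i=m..<n. Z i (\<omega> i) (\<omega> (Suc i)))) else 0)"
  case base
  have "integrable M (\<lambda>\<omega>. if \<omega> m \<in> A m then 1 else 0 :: real)"
    by (rule coordinate_integrable[where h = "\<lambda>x. if x \<in> A m then 1 else 0"])
  then have "(\<integral>\<omega>. (if \<omega> m \<in> A m then 1 else 0) \<partial>M) \<le> (\<integral>\<omega>. (1::real) \<partial>M)"
    by (intro integral_mono) auto
  also have "\<dots> = 1" using prob_space by simp
  also have "(\<lambda>\<omega>. if \<omega> m \<in> A m then 1 else 0) = ?G m" by (rule ext) auto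
  finally show ?case by simp
next
  let ?G = "\<lambda>n \<omega>. (if \<forall>i\<in>{m..n}. \<omega> i \<in> A i then exp (\<theta> * (\<Sum>i=m..<n. Z i (\<omega> i) (\<omega> (Suc i)))) else 0)"
  let ?q = "1 + (\<theta> * B)\<^sup>2"
  case (step n)
  have d: "depends_upto n (?G n)" for n
    unfolding depends_upto_def
  proof (intro allI impI)
    fix \<omega> \<omega>' :: "nat \<Rightarrow> 'k" assume h: "\<forall>i\<le>n. \<omega> i = \<omega>' i"
    then have "(\<Sum>i=m..<n. Z i (\<omega> i) (\<omega> (Suc i))) = (\<Sum>i=m..<n. Z i (\<omega>' i) (\<omega>' (Suc i)))"
      by (intro sum.cong) auto
    then show "?G n \<omega> = ?G n \<omega>'" using h by simp
  qed
  let ?e = "\<lambda>x y. exp (\<theta> * Z n x y)"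
  have le: "measure_pmf.expectation (Q n x) (?e x) \<le> ?q" if x: "x \<in> A n" for x
  proof -
    have "?e x j \<le> ?q + \<theta> * Z n x j" for j
    proof -
      have a: "\<bar>\<theta> * Z n x j\<bar> \<le> \<theta> * B"
        using bound[of n x j] \<theta>(1) by (simp add: abs_mult mult_left_mono)
      then have "(\<theta> * Z n x j)\<^sup>2 \<le> (\<theta> * B)\<^sup>2"
        by (metis abs_ge_zero power2_abs power_mono)
      with exp_le_quadratic[of "\<theta> * Z n x j"] a \<theta>(2) show ?thesis by linarith
    qed
    then have "measure_pmf.expectation (Q n x) (?e x)
        \<le> measure_pmf.expectation (Q n x) (\<lambda>j. ?q + \<theta> * Z n x j)"
      by (intro integral_mono integrable_measure_pmf_finite) auto
    also have "\<dots> = ?q + \<theta> * measure_pmf.expectation (Q n x) (Z n x)"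
      by (subst Bochner_Integration.integral_add) (auto intro!: integrable_measure_pmf_finite)
    also have "\<dots> \<le> ?q"
      using mean[OF _ x] step(1) \<theta>(1) by (simp add: mult_nonneg_nonpos)
    finally show ?thesis .
  qed
  have nn: "0 \<le> ?G n \<omega>" for n \<omega> by simp
  \<comment> \<open>Forgetting the constraint at \<open>Suc n\<close> only increases the integrand
    and leaves a product to which the Markov property applies.\<close>
  have "(\<integral>\<omega>. ?G (Suc n) \<omega> \<partial>M) \<le> (\<integral>\<omega>. ?G n \<omega> * ?e (\<omega> n) (\<omega> (Suc n)) \<partial>M)"
  proof (rule integral_mono)
    show "integrable M (?G (Suc n))" by (rule finite_dim_integrable[OF d])
    show "integrable M (\<lambda>\<omega>. ?G n \<omega> * ?e (\<omega> n) (\<omega> (Suc n)))"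
    proof (rule finite_dim_integrable[of "Suc n"])
      show "depends_upto (Suc n) (\<lambda>\<omega>. ?G n \<omega> * ?e (\<omega> n) (\<omega> (Suc n)))"
        unfolding depends_upto_def
      proof (intro allI impI)
        fix \<omega> \<omega>' :: "nat \<Rightarrow> 'k" assume h: "\<forall>i\<le>Suc n. \<omega> i = \<omega>' i"
        have "?G n \<omega> = ?G n \<omega>'" by (rule depends_uptoD[OF d]) (simp add: h)
        then show "?G n \<omega> * ?e (\<omega> n) (\<omega> (Suc n)) = ?G n \<omega>' * ?e (\<omega>' n) (\<omega>' (Suc n))"
          using h by (simp only: le_SucI order_refl)
      qed
    qed
    fix \<omega> :: "nat \<Rightarrow> 'k"
    show "?G (Suc n) \<omega> \<le> ?G n \<omega> * ?e (\<omega> n) (\<omega> (Suc n))"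
      using step(1) by (auto simp: exp_add[symmetric] algebra_simps)
  qed
  also have "\<dots> = (\<integral>\<omega>. ?G n \<omega> * measure_pmf.expectation (Q n (\<omega> n)) (?e (\<omega> n)) \<partial>M)"
    unfolding expectation_pmf_finite by (rule markov_property[OF d])
  also have "\<dots> \<le> (\<integral>\<omega>. ?G n \<omega> * ?q \<partial>M)"
  proof (rule integral_mono)
    show "integrable M (\<lambda>\<omega>. ?G n \<omega> * measure_pmf.expectation (Q n (\<omega> n)) (?e (\<omega> n)))"
    proof (rule finite_dim_integrable[of n])
      show "depends_upto n (\<lambda>\<omega>. ?G n \<omega> * measure_pmf.expectation (Q n (\<omega> n)) (?e (\<omega> n)))"
        unfolding depends_upto_def
      proof (intro allI impI)
        fix \<omega> \<omega>' :: "nat \<Rightarrow> 'k" assume h: "\<forall>i\<le>n. \<omega> i = \<omega>' i"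
        have "?G n \<omega> = ?G n \<omega>'" by (rule depends_uptoD[OF d]) (simp add: h)
        then show "?G n \<omega> * measure_pmf.expectation (Q n (\<omega> n)) (?e (\<omega> n))
            = ?G n \<omega>' * measure_pmf.expectation (Q n (\<omega>' n)) (?e (\<omega>' n))"
          using h by (simp only: order_refl)
      qed
    qed
    show "integrable M (\<lambda>\<omega>. ?G n \<omega> * ?q)"
      by (intro integrable_mult_left finite_dim_integrable[OF d])
    fix \<omega> :: "nat \<Rightarrow> 'k"
    show "?G n \<omega> * measure_pmf.expectation (Q n (\<omega> n)) (?e (\<omega> n)) \<le> ?G n \<omega> * ?q"
      using le[of "\<omega> n"] step(1) by auto
  qed
  also have "\<dots> = (\<integral>\<omega>. ?G n \<omega> \<partial>M) * ?q" by simp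
  also have "\<dots> \<le> ?q ^ (n - m) * ?q"
    by (intro mult_right_mono step.IH) simp
  also have "\<dots> = ?q ^ (Suc n - m)" using step(1) by (simp add: Suc_diff_le)
  finally show ?case .
qed

text \<open>Markov's inequality for the exponential gives geometrically small probabilities
  \<open>b ^ n\<close>, and Borel-Cantelli applies. \<open>closed\<close> ensures that almost every
  path starting in \<open>A m\<close> stays in \<open>A\<close>, where the truncation is
  invisible.\<close>

lemma AE_sum_le_of_nonpos_drift:
  fixes Z :: "nat \<Rightarrow> 'k \<Rightarrow> 'k \<Rightarrow> real" and A :: "nat \<Rightarrow> 'k set"
  assumes bound: "\<And>n x y. \<bar>Z n x y\<bar> \<le> B"
    and mean: "\<And>n x. m \<le> n \<Longrightarrow> x \<in> A n \<Longrightarrow> measure_pmf.expectation (Q n x) (Z n x) \<le> 0"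
    and closed: "\<And>n x. m \<le> n \<Longrightarrow> x \<in> A n \<Longrightarrow> set_pmf (Q n x) \<subseteq> A (Suc n)"
    and \<delta>: "0 < \<delta>"
  shows "AE \<omega> in M. \<omega> m \<in> A m \<longrightarrow>
    (\<forall>\<^sub>F n in sequentially. (\<Sum>i=m..<n. Z i (\<omega> i) (\<omega> (Suc i))) < \<delta> * real n)"
proof -
  \<comment> \<open>Enlarging \<open>B\<close> to at least \<open>\<delta>\<close> makes
    \<open>C\<close> positive and gives \<open>\<theta> * C \<le> 1\<close>. The choice of
    \<open>\<theta>\<close> minimises the exponent
    \<open>(\<theta> * C)\<^sup>2 - \<theta> * \<delta>\<close>, with minimum
    \<open>- (\<delta>\<^sup>2 / (4 * C\<^sup>2))\<close>.\<close>
  define C where "C = max B \<delta>"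
  have C: "0 < C" "\<delta> \<le> C" "\<And>n x y. \<bar>Z n x y\<bar> \<le> C"
    using bound \<delta> by (auto simp: C_def intro: le_max_iff_disj[THEN iffD2])
  define \<theta> where "\<theta> = \<delta> / (2 * C\<^sup>2)"
  have \<theta>: "0 < \<theta>" "\<theta> * C \<le> 1"
    using C \<delta> by (auto simp: \<theta>_def power2_eq_square field_simps)
  let ?G = "\<lambda>n \<omega>. (if \<forall>i\<in>{m..n}. \<omega> i \<in> A i then exp (\<theta> * (\<Sum>i=m..<n. Z i (\<omega> i) (\<omega> (Suc i)))) else 0)"
  define b where "b = exp (- (\<delta>\<^sup>2 / (4 * C\<^sup>2)))"
  have b: "0 < b" "b < 1" using \<delta> C by (auto simp: b_def)
  have d: "depends_upto n (?G n)" for n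
    unfolding depends_upto_def
  proof (intro allI impI)
    fix \<omega> \<omega>' :: "nat \<Rightarrow> 'k" assume h: "\<forall>i\<le>n. \<omega> i = \<omega>' i"
    then have "(\<Sum>i=m..<n. Z i (\<omega> i) (\<omega> (Suc i))) = (\<Sum>i=m..<n. Z i (\<omega>' i) (\<omega>' (Suc i)))"
      by (intro sum.cong) auto
    then show "?G n \<omega> = ?G n \<omega>'" using h by simp
  qed
  define E where "E n = {\<omega>. exp (\<theta> * \<delta> * real n) \<le> ?G n \<omega>}" for n
  have E: "E n \<in> sets M" for n
  proof -
    have [measurable]: "?G n \<in> borel_measurable M" by (rule borel_measurable_integrable[OF finite_dim_integrable[OF d]])
    have "{\<omega> \<in> space M. exp (\<theta> * \<delta> * real n) \<le> ?G n \<omega>} \<in> sets M" by measurable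
    then show ?thesis by (simp add: E_def)
  qed
  have mE: "measure M (E n) \<le> b ^ n" if n: "m \<le> n" for n
  proof -
    have "measure M (E n) \<le> (\<integral>\<omega>. ?G n \<omega> \<partial>M) / exp (\<theta> * \<delta> * real n)"
      using integral_Markov_inequality_measure[OF finite_dim_integrable[OF d[of n]], of "{}" "exp (\<theta> * \<delta> * real n)"]
      by (simp add: E_def)
    also have "\<dots> \<le> (1 + (\<theta> * C)\<^sup>2) ^ (n - m) / exp (\<theta> * \<delta> * real n)"
      using exponential_supermartingale[of Z C m A \<theta> n, OF C(3) mean less_imp_le[OF \<theta>(1)] \<theta>(2) n]
      by (simp add: divide_right_mono)
    also have "(1 + (\<theta> * C)\<^sup>2) ^ (n - m) \<le> (1 + (\<theta> * C)\<^sup>2) ^ n"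
      by (intro power_increasing) auto
    also have "(1 + (\<theta> * C)\<^sup>2) ^ n \<le> exp ((\<theta> * C)\<^sup>2) ^ n"
      by (intro power_mono) (auto simp: exp_ge_add_one_self)
    also have "exp ((\<theta> * C)\<^sup>2) ^ n / exp (\<theta> * \<delta> * real n) = exp (((\<theta> * C)\<^sup>2 - \<theta> * \<delta>) * real n)"
      by (simp add: exp_of_nat_mult[symmetric] exp_diff[symmetric] algebra_simps)
    also have "(\<theta> * C)\<^sup>2 - \<theta> * \<delta> = - (\<delta>\<^sup>2 / (4 * C\<^sup>2))"
      using C by (simp add: \<theta>_def power2_eq_square field_simps)
    also have "exp (- (\<delta>\<^sup>2 / (4 * C\<^sup>2)) * real n) = b ^ n"
      by (simp add: b_def exp_of_nat_mult[symmetric] mult.commute)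
    finally show ?thesis by (simp add: divide_right_mono)
  qed
  have "AE \<omega> in M. \<forall>\<^sub>F n in sequentially. \<omega> \<in> space M - E n"
  proof (rule borel_cantelli_AE1[OF E])
    show "emeasure M (E n) < \<infinity>" for n by (simp add: emeasure_eq_measure)
    show "summable (\<lambda>n. measure M (E n))"
      by (rule summable_comparison_test'[of "\<lambda>n. b ^ n" m])
         (use b mE in \<open>auto intro!: summable_geometric\<close>)
  qed
  with AE_transition show ?thesis
  proof eventually_elim
    case (elim \<omega>)
    show ?case
    proof
      assume start: "\<omega> m \<in> A m"
      have path: "\<omega> n \<in> A n" if "m \<le> n" for n
        using that by (induction rule: dec_induct) (use start elim(1) closed in blast)+
      from elim(2) show "\<forall>\<^sub>F n in sequentially. (\<Sum>i=m..<n. Z i (\<omega> i) (\<omega> (Suc i))) < \<delta> * real n"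
      proof eventually_elim
        case (elim n)
        then have "exp (\<theta> * (\<Sum>i=m..<n. Z i (\<omega> i) (\<omega> (Suc i)))) < exp (\<theta> * \<delta> * real n)"
          using path by (auto simp: E_def not_le)
        then show ?case using \<theta> by (simp add: mult.assoc)
      qed
    qed
  qed
qed

text \<open>\<open>u\<close> acts as a bounded potential: the defect \<open>Z\<close> has
  nonpositive drift on \<open>A\<close>, and in its sum the differences of \<open>u\<close>
  telescope, so they vanish after division by \<open>n\<close>.\<close>

lemma AE_average_ge_of_drift:
  fixes r u :: "nat \<Rightarrow> 'k \<Rightarrow> real" and A :: "nat \<Rightarrow> 'k set"
  assumes r: "\<And>n x. 0 \<le> r n x" "\<And>n x. r n x \<le> 1" and u: "\<And>n x. \<bar>u n x\<bar> \<le> D"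
    and drift: "\<And>n x. m \<le> n \<Longrightarrow> x \<in> A n \<Longrightarrow> c + u n x \<le> r n x + measure_pmf.expectation (Q n x) (u (Suc n))"
    and closed: "\<And>n x. m \<le> n \<Longrightarrow> x \<in> A n \<Longrightarrow> set_pmf (Q n x) \<subseteq> A (Suc n)"
  shows "AE \<omega> in M. \<omega> m \<in> A m \<longrightarrow> ereal c \<le> liminf (\<lambda>n. ereal ((\<Sum>i<n. r i (\<omega> i)) / real n))"
proof -
  define Z where "Z n x y = c - r n x + u n x - u (Suc n) y" for n x y
  have "AE \<omega> in M. \<forall>k. \<omega> m \<in> A m \<longrightarrow>
    (\<forall>\<^sub>F n in sequentially. (\<Sum>i=m..<n. Z i (\<omega> i) (\<omega> (Suc i))) < inverse (real (Suc k)) * real n)"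
  proof (subst AE_all_countable, intro allI AE_sum_le_of_nonpos_drift[where B = "\<bar>c\<bar> + 1 + 2 * D"])
    fix n x
    show "\<bar>Z n x y\<bar> \<le> \<bar>c\<bar> + 1 + 2 * D" for y
      using r[of n x] u[of n x] u[of "Suc n" y] by (simp add: Z_def)
    assume n: "m \<le> n" and x: "x \<in> A n"
    have "measure_pmf.expectation (Q n x) (Z n x)
        = c - r n x + u n x - measure_pmf.expectation (Q n x) (u (Suc n))"
      unfolding Z_def
      by (subst Bochner_Integration.integral_diff) (auto intro!: integrable_measure_pmf_finite)
    then show "measure_pmf.expectation (Q n x) (Z n x) \<le> 0" using drift[OF n x] by simp
    show "set_pmf (Q n x) \<subseteq> A (Suc n)" by (rule closed[OF n x])
  qed simp
  then show ?thesis
  proof eventually_elim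
    case (elim \<omega>)
    show ?case
    proof
      assume "\<omega> m \<in> A m"
      then have ev: "\<forall>\<^sub>F n in sequentially. (\<Sum>i=m..<n. Z i (\<omega> i) (\<omega> (Suc i))) < inverse (real (Suc k)) * real n" for k
        using elim by blast
      show "ereal c \<le> liminf (\<lambda>n. ereal ((\<Sum>i<n. r i (\<omega> i)) / real n))"
        unfolding le_Liminf_iff
      proof (intro allI impI)
        fix y assume "y < ereal c"
        then obtain z where z: "y < ereal z" "z < c"
          using ereal_dense2[of y "ereal c"] by auto
        obtain k where k: "inverse (real (Suc k)) < (c - z) / 2"
          using reals_Archimedean[of "(c - z) / 2"] z by auto
        \<comment> \<open>\<open>?K\<close> bounds what is lost on the first \<open>m\<close> stages
          and through the two boundary values of \<open>u\<close>. Half of the gap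
          \<open>c - z\<close> absorbs \<open>?K\<close>, the other half the sum of the
          \<open>Z\<close>.\<close>
        let ?K = "\<bar>c\<bar> * real m + 2 * D"
        have "\<forall>\<^sub>F n in sequentially. ?K / ((c - z) / 2) < real n"
          by (rule filterlim_at_top_dense[THEN iffD1, rule_format, OF filterlim_real_sequentially])
        with ev[of k] eventually_gt_at_top[of 0] eventually_ge_at_top[of m]
        show "\<forall>\<^sub>F n in sequentially. y < ereal ((\<Sum>i<n. r i (\<omega> i)) / real n)"
        proof eventually_elim
          case (elim n)
          have "(\<Sum>i=m..<n. Z i (\<omega> i) (\<omega> (Suc i)))
              = c * real (n - m) - (\<Sum>i=m..<n. r i (\<omega> i)) - (\<Sum>i=m..<n. u (Suc i) (\<omega> (Suc i)) - u i (\<omega> i))"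
            by (simp add: Z_def sum.distrib sum_subtractf)
          also have "(\<Sum>i=m..<n. u (Suc i) (\<omega> (Suc i)) - u i (\<omega> i)) = u n (\<omega> n) - u m (\<omega> m)"
            using elim(3) by (rule sum_Suc_diff')
          finally have eq: "(\<Sum>i=m..<n. r i (\<omega> i))
              = c * real (n - m) - (u n (\<omega> n) - u m (\<omega> m)) - (\<Sum>i=m..<n. Z i (\<omega> i) (\<omega> (Suc i)))" by simp
          have split: "(\<Sum>i<n. r i (\<omega> i)) = (\<Sum>i<m. r i (\<omega> i)) + (\<Sum>i=m..<n. r i (\<omega> i))"
            using elim(3) by (metis atLeast0LessThan sum.atLeastLessThan_concat zero_le)
          have pos: "0 \<le> (\<Sum>i<m. r i (\<omega> i))" by (simp add: sum_nonneg r)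
          have c1: "c * real (n - m) \<ge> c * real n - \<bar>c\<bar> * real m"
            using elim(3) mult_right_mono[OF abs_ge_self[of c], of "real m"] by (simp add: of_nat_diff algebra_simps)
          have "inverse (real (Suc k)) * real n \<le> (c - z) / 2 * real n"
            using k by (intro mult_right_mono) auto
          moreover have "?K < (c - z) / 2 * real n"
            using elim(4) z by (simp add: field_simps)
          moreover have "\<bar>u n (\<omega> n)\<bar> \<le> D" "\<bar>u m (\<omega> m)\<bar> \<le> D" by (rule u)+
          ultimately have "(\<Sum>i<n. r i (\<omega> i)) > c * real n - 2 * ((c - z) / 2 * real n)"
            using elim(1) eq split pos c1 by linarith
          moreover have "c * real n - 2 * ((c - z) / 2 * real n) = z * real n" by (simp add: field_simps)
          ultimately have "z * real n < (\<Sum>i<n. r i (\<omega> i))" by simp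
          then have "z < (\<Sum>i<n. r i (\<omega> i)) / real n" using elim(2) by (simp add: pos_less_divide_eq)
          with z(1) show ?case by (metis ereal_less_eq(3) less_imp_le order_less_le_trans)
        qed
      qed
    qed
  qed
qed

end

section \<open>Words of actions\<close>

lemma integrable_finite_pmf [simp]:
  "integrable (measure_pmf (p :: 'k::finite pmf)) (f :: 'k \<Rightarrow> real)"
  by (rule integrable_measure_pmf_finite) simp

primrec word_kernel :: "('a \<Rightarrow> 'k \<Rightarrow> 'k pmf) \<Rightarrow> 'a list \<Rightarrow> 'k \<Rightarrow> 'k pmf" where
  "word_kernel P [] k = return_pmf k"
| "word_kernel P (a # w) k = bind_pmf (P a k) (word_kernel P w)"

primrec word_reward :: "('a \<Rightarrow> 'k \<Rightarrow> 'k pmf) \<Rightarrow> ('k \<Rightarrow> 'a \<Rightarrow> real) \<Rightarrow> 'a list \<Rightarrow> 'k \<Rightarrow> real" where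
  "word_reward P g [] k = 0"
| "word_reward P g (a # w) k = g k a + measure_pmf.expectation (P a k) (word_reward P g w)"

lemma word_kernel_Nil: "word_kernel P [] = return_pmf"
  by (rule ext) simp

lemma word_reward_Nil: "word_reward P g [] = (\<lambda>_. 0)"
  by (rule ext) simp

lemma word_kernel_single: "word_kernel P [a] = P a"
  by (rule ext) (simp add: word_kernel_Nil bind_return_pmf')

lemma word_reward_single: "word_reward P g [a] = (\<lambda>k. g k a)"
  by (rule ext) (simp add: word_reward_Nil)

lemma word_kernel_append: "word_kernel P (v @ w) = (\<lambda>k. bind_pmf (word_kernel P v k) (word_kernel P w))"
  by (induction v) (auto simp: fun_eq_iff[of "word_kernel P (_ # _)"] bind_return_pmf bind_assoc_pmf)

lemma word_reward_append:
  fixes P :: "'a \<Rightarrow> 'k::finite \<Rightarrow> 'k pmf"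
  shows "word_reward P g (v @ w) = (\<lambda>k. word_reward P g v k + measure_pmf.expectation (word_kernel P v k) (word_reward P g w))"
  by (induction v) (auto simp: fun_eq_iff[of "word_reward P g (_ # _)"] expectation_bind_pmf_finite)

lemma
  fixes P :: "'a \<Rightarrow> 'k::finite \<Rightarrow> 'k pmf"
  assumes "\<And>k a. 0 \<le> g k a" "\<And>k a. g k a \<le> 1"
  shows word_reward_nonneg: "0 \<le> word_reward P g w k" and word_reward_le_length: "word_reward P g w k \<le> real (length w)"
proof -
  show "0 \<le> word_reward P g w k"
    by (induction w arbitrary: k) (auto intro!: add_nonneg_nonneg assms)
  show "word_reward P g w k \<le> real (length w)"
  proof (induction w arbitrary: k)
    case (Cons a w)
    have "measure_pmf.expectation (P a k) (word_reward P g w) \<le> measure_pmf.expectation (P a k) (\<lambda>_. real (length w))"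
      using Cons by (intro integral_mono) auto
    with assms(2)[of k a] show ?case by simp
  qed simp
qed

text \<open>Finitely many words of length \<open>l\<close> and states give finitely many positive
  probabilities. The bound depends on \<open>l\<close>, so later the window length has to be chosen
  after \<open>l\<close>. Inserting \<open>1\<close> keeps the minimum over a nonempty set.\<close>

lemma word_kernel_prob_lower_bound:
  fixes P :: "'a::finite \<Rightarrow> 'k::finite \<Rightarrow> 'k pmf"
  shows "\<exists>\<eta>>0. \<forall>w k j. length w = l \<longrightarrow> j \<in> set_pmf (word_kernel P w k) \<longrightarrow> \<eta> \<le> pmf (word_kernel P w k) j"
proof -
  let ?W = "{w :: 'a list. length w = l}"
  let ?S = "{x \<in> (\<lambda>(w, k, j). pmf (word_kernel P w k) j) ` (?W \<times> UNIV \<times> UNIV). 0 < x}"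
  have W: "finite ?W" using finite_lists_length_eq[of "UNIV :: 'a set" l] by simp
  then have fin: "finite (insert 1 ?S)" by simp
  show ?thesis
  proof (intro exI[of _ "Min (insert 1 ?S)"] conjI allI impI)
    show "0 < Min (insert 1 ?S)" using fin by (subst Min_gr_iff) auto
    fix w k j assume "length w = l" "j \<in> set_pmf (word_kernel P w k)"
    then have "pmf (word_kernel P w k) j \<in> insert 1 ?S"
      by (auto simp: pmf_positive intro!: image_eqI[of _ _ "(w, k, j)"])
    then show "Min (insert 1 ?S) \<le> pmf (word_kernel P w k) j" by (rule Min_le[OF fin])
  qed
qed

section \<open>Windows cut out of an action sequence\<close>

definition seg :: "(nat \<Rightarrow> 'a) \<Rightarrow> nat \<Rightarrow> nat \<Rightarrow> 'a list" where
  "seg \<sigma> m n = map \<sigma> [m..<m+n]"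

lemma length_seg [simp]: "length (seg \<sigma> m n) = n"
  by (simp add: seg_def)

lemma seg_add: "seg \<sigma> m (a + b) = seg \<sigma> m a @ seg \<sigma> (m + a) b"
  unfolding seg_def map_append[symmetric] add.assoc[symmetric]
  by (subst upt_add_eq_append) simp_all

lemma seg_0 [simp]: "seg \<sigma> m 0 = []"
  by (simp add: seg_def)

lemma seg_Suc: "seg \<sigma> m (Suc n) = seg \<sigma> m n @ [\<sigma> (m + n)]"
  by (simp add: seg_def)

lemma belief_seg:
  "belief p (\<lambda>i. P (\<sigma> i)) (m + l) = bind_pmf (belief p (\<lambda>i. P (\<sigma> i)) m) (word_kernel P (seg \<sigma> m l))"
proof (induction l)
  case (Suc l)
  then show ?case by (simp add: seg_Suc word_kernel_append word_kernel_single bind_assoc_pmf)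
qed (simp add: word_kernel_Nil bind_return_pmf')

lemma sum_belief_reward:
  fixes P :: "'a \<Rightarrow> 'k::finite \<Rightarrow> 'k pmf"
  shows "(\<Sum>i=m..<m+n. measure_pmf.expectation (belief p (\<lambda>i. P (\<sigma> i)) i) (\<lambda>k. g k (\<sigma> i)))
    = measure_pmf.expectation (belief p (\<lambda>i. P (\<sigma> i)) m) (word_reward P g (seg \<sigma> m n))"
proof (induction n)
  case (Suc n)
  let ?b = "belief p (\<lambda>i. P (\<sigma> i))"
  have "measure_pmf.expectation (?b m) (word_reward P g (seg \<sigma> m (Suc n)))
     = measure_pmf.expectation (?b m) (word_reward P g (seg \<sigma> m n))
       + measure_pmf.expectation (?b (m + n)) (\<lambda>k. g k (\<sigma> (m + n)))"
    by (simp add: seg_Suc word_reward_append word_reward_single belief_seg expectation_bind_pmf_finite)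
  with Suc show ?case by simp
qed simp

section \<open>Second-moment bound for unstable states\<close>

lemma expectation_square_deviation:
  fixes p :: "'k::finite pmf" and Y :: "'k \<Rightarrow> real"
  shows "measure_pmf.expectation p (\<lambda>j. (Y j - x)\<^sup>2)
    = measure_pmf.expectation p (\<lambda>j. (Y j)\<^sup>2) - 2 * x * measure_pmf.expectation p Y + x\<^sup>2"
proof -
  have "(\<lambda>j. (Y j - x)\<^sup>2) = (\<lambda>j. (Y j)\<^sup>2 - 2 * x * Y j + x\<^sup>2)"
    by (simp add: power2_diff algebra_simps)
  then show ?thesis by simp
qed

text \<open>After expanding the square, only the cross term needs work: the conditional mean of
  \<open>X (m + l)\<close> is at least \<open>X m k - l\<close>, since shifting the window by
  \<open>l\<close> loses at most the first \<open>l\<close> rewards, and \<open>X m k\<close> is at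
  most \<open>n\<close>.\<close>

lemma square_increment_bound:
  fixes P :: "'a \<Rightarrow> 'k::finite \<Rightarrow> 'k pmf" and p :: "'k pmf" and \<sigma> :: "nat \<Rightarrow> 'a" and n :: nat
  assumes g: "\<And>k a. 0 \<le> g k a" "\<And>k a. g k a \<le> 1"
  defines "b \<equiv> belief p (\<lambda>i. P (\<sigma> i))"
  defines "X \<equiv> \<lambda>m. word_reward P g (seg \<sigma> m n)"
  shows "measure_pmf.expectation (b m) (\<lambda>k. measure_pmf.expectation (word_kernel P (seg \<sigma> m l) k) (\<lambda>j. (X (m + l) j - X m k)\<^sup>2))
    \<le> measure_pmf.expectation (b (m + l)) (\<lambda>j. (X (m + l) j)\<^sup>2)
      - measure_pmf.expectation (b m) (\<lambda>k. (X m k)\<^sup>2) + 2 * real n * real l"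
proof -
  have pt: "measure_pmf.expectation (word_kernel P (seg \<sigma> m l) k) (\<lambda>j. (X (m + l) j - X m k)\<^sup>2)
     \<le> measure_pmf.expectation (word_kernel P (seg \<sigma> m l) k) (\<lambda>j. (X (m + l) j)\<^sup>2) - (X m k)\<^sup>2 + 2 * real n * real l" for k
  proof -
    define x where "x = X m k"
    define y where "y = measure_pmf.expectation (word_kernel P (seg \<sigma> m l) k) (X (m + l))"
    have x: "0 \<le> x" "x \<le> real n"
      using word_reward_nonneg[of g P "seg \<sigma> m n" k] word_reward_le_length[of g P "seg \<sigma> m n" k] g by (auto simp: x_def X_def)
    \<comment> \<open>The same stretch of \<open>l + n\<close> stages is split in two ways, after
      \<open>l\<close> steps and after \<open>n\<close> steps.\<close>
    have "word_reward P g (seg \<sigma> m (l + n)) k = word_reward P g (seg \<sigma> m l) k + y"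
      by (simp add: seg_add word_reward_append y_def X_def)
    moreover have "word_reward P g (seg \<sigma> m (n + l)) k \<ge> x"
      by (simp add: seg_add word_reward_append x_def X_def word_reward_nonneg g)
    moreover have "word_reward P g (seg \<sigma> m l) k \<le> real l"
      using word_reward_le_length[of g P "seg \<sigma> m l" k] g by simp
    ultimately have "x - real l \<le> y" by (simp add: add.commute)
    then have "2 * x * (x - real l) \<le> 2 * x * y" using x by (intro mult_left_mono) auto
    moreover have "x * real l \<le> real n * real l" using x by (intro mult_right_mono) auto
    ultimately show ?thesis
      unfolding expectation_square_deviation x_def[symmetric] y_def[symmetric]
      by (simp add: power2_eq_square algebra_simps)
  qed
  have "measure_pmf.expectation (b m) (\<lambda>k. measure_pmf.expectation (word_kernel P (seg \<sigma> m l) k) (\<lambda>j. (X (m + l) j - X m k)\<^sup>2))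
    \<le> measure_pmf.expectation (b m) (\<lambda>k. measure_pmf.expectation (word_kernel P (seg \<sigma> m l) k) (\<lambda>j. (X (m + l) j)\<^sup>2) - (X m k)\<^sup>2 + 2 * real n * real l)"
    by (intro integral_mono pt) auto
  also have "\<dots> = measure_pmf.expectation (b (m + l)) (\<lambda>j. (X (m + l) j)\<^sup>2)
      - measure_pmf.expectation (b m) (\<lambda>k. (X m k)\<^sup>2) + 2 * real n * real l"
    by (simp add: b_def belief_seg expectation_bind_pmf_finite)
  finally show ?thesis .
qed

text \<open>The states \<open>k\<close> from which, \<open>l\<close> steps after stage \<open>m\<close>, some reachable state has a noticeably worse
  outlook over the next \<open>n\<close> stages than \<open>k\<close> had at stage \<open>m\<close>.\<close>

definition unstable :: "('a \<Rightarrow> 'k \<Rightarrow> 'k pmf) \<Rightarrow> ('k \<Rightarrow> 'a \<Rightarrow> real) \<Rightarrow> (nat \<Rightarrow> 'a) \<Rightarrow> real \<Rightarrow> nat \<Rightarrow> nat \<Rightarrow> nat \<Rightarrow> 'k set" where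
  "unstable P g \<sigma> e l n m = {k. \<exists>j\<in>set_pmf (word_kernel P (seg \<sigma> m l) k).
     word_reward P g (seg \<sigma> (m + l) n) j < word_reward P g (seg \<sigma> m n) k - e * real n}"

text \<open>From an unstable state a deviation larger than \<open>e * n\<close> occurs with
  probability at least \<open>\<eta>\<close>, so its mean squared deviation is at least
  \<open>\<eta> * (e * n)\<^sup>2\<close>. Summed over the stages, the bound on mean squared
  deviations telescopes.\<close>

lemma sum_prob_unstable_le:
  fixes P :: "'a \<Rightarrow> 'k::finite \<Rightarrow> 'k pmf"
  assumes g: "\<And>k a. 0 \<le> g k a" "\<And>k a. g k a \<le> 1"
    and \<eta>: "0 < \<eta>" "\<And>w k j. length w = l \<Longrightarrow> j \<in> set_pmf (word_kernel P w k) \<Longrightarrow> \<eta> \<le> pmf (word_kernel P w k) j"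
    and e: "0 < e" and n: "1 \<le> n"
  shows "(\<Sum>m<N. measure (belief p (\<lambda>i. P (\<sigma> i)) m) (unstable P g \<sigma> e l n m))
    \<le> real l / (\<eta> * e\<^sup>2) + 2 * real l / (real n * \<eta> * e\<^sup>2) * real N"
proof -
  define b where "b = belief p (\<lambda>i. P (\<sigma> i))"
  define X where "X m = word_reward P g (seg \<sigma> m n)" for m
  define a where "a m = measure_pmf.expectation (b m) (\<lambda>k. (X m k)\<^sup>2)" for m
  define D where "D m = measure_pmf.expectation (b m) (\<lambda>k. measure_pmf.expectation (word_kernel P (seg \<sigma> m l) k) (\<lambda>j. (X (m + l) j - X m k)\<^sup>2))" for m
  define U where "U m = unstable P g \<sigma> e l n m" for m
  let ?c = "\<eta> * (e * real n)\<^sup>2"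
  have c: "0 < ?c" using \<eta> e n by simp
  have D: "D m \<le> a (m + l) - a m + 2 * real n * real l" for m
    using square_increment_bound[where g = g and P = P and p = p and \<sigma> = \<sigma> and l = l and n = n and m = m, OF g] by (simp add: D_def a_def X_def b_def)
  have U: "?c * measure (b m) (U m) \<le> D m" for m
  proof -
    have "?c * measure (b m) (U m) = measure_pmf.expectation (b m) (\<lambda>k. ?c * indicator (U m) k)" by simp
    also have "\<dots> \<le> D m"
      unfolding D_def
    proof (intro integral_mono)
      fix k
      let ?t = "word_kernel P (seg \<sigma> m l) k"
      have nn: "0 \<le> measure_pmf.expectation ?t (\<lambda>j. (X (m + l) j - X m k)\<^sup>2)" by simp
      show "?c * indicator (U m) k \<le> measure_pmf.expectation ?t (\<lambda>j. (X (m + l) j - X m k)\<^sup>2)"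
      proof (cases "k \<in> U m")
        case True
        then obtain j where j: "j \<in> set_pmf ?t" "X (m + l) j < X m k - e * real n"
          by (auto simp: U_def unstable_def X_def)
        have "(e * real n)\<^sup>2 \<le> (X m k - X (m + l) j)\<^sup>2"
          using j e by (intro power_mono) auto
        then have "?c \<le> pmf ?t j * (X (m + l) j - X m k)\<^sup>2"
          using \<eta>(2)[OF _ j(1)] \<eta>(1) by (intro mult_mono) (auto simp: power2_commute)
        also have "\<dots> \<le> (\<Sum>i\<in>UNIV. pmf ?t i * (X (m + l) i - X m k)\<^sup>2)"
          by (rule member_le_sum[of j UNIV "\<lambda>i. pmf ?t i * (X (m + l) i - X m k)\<^sup>2"]) auto
        finally show ?thesis using True by (simp add: expectation_pmf_finite)
      qed (use nn in simp)
    qed auto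
    finally show ?thesis .
  qed
  have a01: "0 \<le> a m" "a m \<le> (real n)\<^sup>2" for m
  proof -
    show "0 \<le> a m" by (simp add: a_def)
    have "a m \<le> measure_pmf.expectation (b m) (\<lambda>_. (real n)\<^sup>2)"
      unfolding a_def X_def using word_reward_nonneg[of g P "seg \<sigma> m n"] word_reward_le_length[of g P "seg \<sigma> m n"] g
      by (intro integral_mono power_mono) auto
    then show "a m \<le> (real n)\<^sup>2" by simp
  qed
  \<comment> \<open>Raising the shift \<open>l\<close> by one adds a telescoping sum equal to
    \<open>a (N + l) - a l\<close>, at most \<open>(real n)\<^sup>2\<close>.\<close>
  have tele: "(\<Sum>m<N. a (m + l) - a m) \<le> real l * (real n)\<^sup>2"
  proof (induction l)
    case (Suc l)
    have "(\<Sum>m<N. a (m + Suc l) - a m) = (\<Sum>m<N. a (m + l) - a m) + (\<Sum>m<N. a (Suc m + l) - a (m + l))"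
      by (simp add: sum.distrib[symmetric])
    also have "(\<Sum>m<N. a (Suc m + l) - a (m + l)) = a (N + l) - a l"
      using sum_lessThan_telescope[of "\<lambda>m. a (m + l)" N] by simp
    finally show ?case using Suc a01[of l] a01[of "N + l"] by (simp add: algebra_simps)
  qed simp
  have "?c * (\<Sum>m<N. measure (b m) (U m)) \<le> (\<Sum>m<N. a (m + l) - a m + 2 * real n * real l)"
    unfolding sum_distrib_left using U D by (intro sum_mono) (meson order_trans)
  also have "\<dots> \<le> real l * (real n)\<^sup>2 + 2 * real n * real l * real N"
    using tele by (simp add: sum.distrib mult.commute)
  finally have "(\<Sum>m<N. measure (b m) (U m)) \<le> (real l * (real n)\<^sup>2 + 2 * real n * real l * real N) / ?c"
    using c by (simp add: pos_le_divide_eq mult.commute)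
  also have "\<dots> = real l / (\<eta> * e\<^sup>2) + 2 * real l / (real n * \<eta> * e\<^sup>2) * real N"
    using \<eta> e n by (simp add: field_simps power2_eq_square)
  finally show ?thesis by (simp add: b_def U_def)
qed

section \<open>The lower average reward as a random variable\<close>

definition lower_average :: "(nat \<Rightarrow> 'k \<Rightarrow> real) \<Rightarrow> (nat \<Rightarrow> 'k) \<Rightarrow> real" where
  "lower_average r \<omega> = real_of_ereal (liminf (\<lambda>n. ereal ((\<Sum>i<n. r i (\<omega> i)) / real n)))"

text \<open>All averages lie in the unit interval (the one at \<open>0\<close> being
  \<open>0\<close> by division by zero), so the \<open>liminf\<close> is finite and
  \<open>real_of_ereal\<close> loses nothing.\<close>

lemma
  assumes r: "\<And>n x. 0 \<le> r n x" "\<And>n x. r n x \<le> 1"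
  shows ereal_lower_average: "ereal (lower_average r \<omega>) = liminf (\<lambda>n. ereal ((\<Sum>i<n. r i (\<omega> i)) / real n))"
    and lower_average_nonneg: "0 \<le> lower_average r \<omega>"
    and lower_average_le_1: "lower_average r \<omega> \<le> 1"
proof -
  let ?L = "liminf (\<lambda>n. ereal ((\<Sum>i<n. r i (\<omega> i)) / real n))"
  have a0: "0 \<le> (\<Sum>i<n. r i (\<omega> i)) / real n" for n by (simp add: sum_nonneg r)
  have a1: "(\<Sum>i<n. r i (\<omega> i)) / real n \<le> 1" for n
  proof -
    have "(\<Sum>i<n. r i (\<omega> i)) \<le> (\<Sum>i<n. 1)" by (intro sum_mono r)
    then show ?thesis by (cases "n = 0") (simp_all add: divide_le_eq)
  qed
  have L0: "0 \<le> ?L" by (rule Liminf_bounded) (simp add: a0)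
  have "?L \<le> liminf (\<lambda>n. ereal 1)" by (rule Liminf_mono) (simp add: a1)
  then have L1: "?L \<le> 1" by (simp add: Liminf_const one_ereal_def)
  show eq: "ereal (lower_average r \<omega>) = ?L"
    unfolding lower_average_def using L0 L1 by (intro ereal_real') auto
  from L0 show "0 \<le> lower_average r \<omega>" unfolding eq[symmetric] by simp
  from L1 show "lower_average r \<omega> \<le> 1" unfolding eq[symmetric] by simp
qed

context markov_chain
begin

lemma lower_average_measurable [measurable]: "lower_average r \<in> borel_measurable M"
proof -
  have [measurable]: "(\<lambda>\<omega>. r i (\<omega> i)) \<in> borel_measurable M" for i
    by (rule borel_measurable_integrable[OF coordinate_integrable])
  show ?thesis unfolding lower_average_def[abs_def] by measurable
qed

context
  fixes r :: "nat \<Rightarrow> 'k \<Rightarrow> real"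
  assumes r: "\<And>n x. 0 \<le> r n x" "\<And>n x. r n x \<le> 1"
begin

lemma lower_average_integrable: "integrable M (lower_average r)"
  by (rule integrable_const_bound[where B = 1])
     (auto simp: lower_average_nonneg[of r] lower_average_le_1[of r] r)

lemma integral_lower_average_le_1: "(\<integral>\<omega>. lower_average r \<omega> \<partial>M) \<le> 1"
proof -
  have "(\<integral>\<omega>. lower_average r \<omega> \<partial>M) \<le> (\<integral>\<omega>. 1 \<partial>M)"
    by (intro integral_mono lower_average_integrable) (auto simp: lower_average_le_1 r)
  then show ?thesis using prob_space by simp
qed

text \<open>A Fatou argument: the minimum of the lower average and the \<open>n\<close>-th average
  converges to the lower average, so dominated convergence applies to it.\<close>

lemma eventually_sum_belief_ge:
  assumes \<delta>: "0 < \<delta>"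
  shows "\<forall>\<^sub>F n in sequentially. ((\<integral>\<omega>. lower_average r \<omega> \<partial>M) - \<delta>) * real n
    \<le> (\<Sum>i<n. measure_pmf.expectation (belief p Q i) (r i))"
proof -
  define a where "a n \<omega> = (\<Sum>i<n. r i (\<omega> i)) / real n" for n \<omega>
  define f where "f = lower_average r"
  have f01: "0 \<le> f \<omega>" "f \<omega> \<le> 1" for \<omega>
    unfolding f_def by (rule lower_average_nonneg lower_average_le_1, fact r, fact r)+
  have a0: "0 \<le> a n \<omega>" for n \<omega> by (simp add: a_def sum_nonneg r)
  have ai: "integrable M (a n)" for n
    unfolding a_def by (intro integrable_divide Bochner_Integration.integrable_sum coordinate_integrable)
  have fi: "integrable M f" unfolding f_def by (rule lower_average_integrable)
  have lim: "(\<lambda>n. min (f \<omega>) (a n \<omega>)) \<longlonglongrightarrow> f \<omega>" for \<omega>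
  proof (rule LIMSEQ_I)
    fix d :: real assume d: "0 < d"
    have "liminf (\<lambda>n. ereal (a n \<omega>)) = ereal (f \<omega>)"
      unfolding a_def f_def by (rule ereal_lower_average[symmetric]) (fact r)+
    then have "ereal (f \<omega> - d) < liminf (\<lambda>n. ereal (a n \<omega>))" using d by simp
    then have "\<forall>\<^sub>F n in sequentially. ereal (f \<omega> - d) < ereal (a n \<omega>)" by (rule less_LiminfD)
    then obtain N where N: "\<And>n. N \<le> n \<Longrightarrow> f \<omega> - d < a n \<omega>" by (auto simp: eventually_sequentially)
    show "\<exists>N. \<forall>n\<ge>N. norm (min (f \<omega>) (a n \<omega>) - f \<omega>) < d"
      using N d by (intro exI[of _ N]) (force simp: min_def)
  qed
  have "(\<lambda>n. \<integral>\<omega>. min (f \<omega>) (a n \<omega>) \<partial>M) \<longlonglongrightarrow> (\<integral>\<omega>. f \<omega> \<partial>M)"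
  proof (rule integral_dominated_convergence[where w = "\<lambda>_. 1"])
    show "f \<in> borel_measurable M" "(\<lambda>\<omega>. min (f \<omega>) (a n \<omega>)) \<in> borel_measurable M" for n
      using fi ai by auto
    show "AE \<omega> in M. norm (min (f \<omega>) (a n \<omega>)) \<le> 1" for n
    proof (rule AE_I2)
      fix \<omega>
      have "0 \<le> min (f \<omega>) (a n \<omega>)" using f01 a0 by simp
      then show "norm (min (f \<omega>) (a n \<omega>)) \<le> 1" using f01[of \<omega>] by simp
    qed
  qed (use lim in auto)
  then have "\<forall>\<^sub>F n in sequentially. (\<integral>\<omega>. f \<omega> \<partial>M) - \<delta> < (\<integral>\<omega>. min (f \<omega>) (a n \<omega>) \<partial>M)"
    using \<delta> by (intro order_tendstoD) auto
  with eventually_gt_at_top[of 0] show ?thesis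
  proof eventually_elim
    case (elim n)
    have "(\<integral>\<omega>. f \<omega> \<partial>M) - \<delta> \<le> (\<integral>\<omega>. min (f \<omega>) (a n \<omega>) \<partial>M)" using elim by simp
    also have "\<dots> \<le> (\<integral>\<omega>. a n \<omega> \<partial>M)"
      by (intro integral_mono integrable_min fi ai) auto
    also have "\<dots> = (\<integral>\<omega>. (\<Sum>i<n. r i (\<omega> i)) \<partial>M) / real n"
      unfolding a_def by simp
    also have "(\<integral>\<omega>. (\<Sum>i<n. r i (\<omega> i)) \<partial>M) = (\<Sum>i<n. measure_pmf.expectation (belief p Q i) (r i))"
      by (subst Bochner_Integration.integral_sum) (auto simp: integral_coordinate intro: coordinate_integrable)
    finally show ?case using elim by (simp add: f_def pos_le_divide_eq)
  qed
qed

end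

text \<open>The drift criterion is used with the surplus still expected in the current block as
  potential. \<open>A n\<close> collects the states reachable from \<open>S\<close> after the part
  of the block already played.\<close>

lemma AE_periodic_average_ge:
  fixes P :: "'a \<Rightarrow> 'k \<Rightarrow> 'k pmf" and g :: "'k \<Rightarrow> 'a \<Rightarrow> real"
  assumes Q: "Q = (\<lambda>i. P (\<sigma> i))"
    and g: "\<And>k a. 0 \<le> g k a" "\<And>k a. g k a \<le> 1"
    and w: "w \<noteq> []" and per: "\<And>t. \<sigma> (s + t) = w ! (t mod length w)"
    and S: "\<And>j. j \<in> S \<Longrightarrow> set_pmf (word_kernel P w j) \<subseteq> S"
    and c: "\<And>j. j \<in> S \<Longrightarrow> c * real (length w) \<le> word_reward P g w j"
  shows "AE \<omega> in M. \<omega> s \<in> S \<longrightarrow> c \<le> lower_average (\<lambda>i k. g k (\<sigma> i)) \<omega>"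
proof -
  define L where "L = length w"
  have L: "0 < L" using w by (simp add: L_def)
  define \<tau> where "\<tau> n = (n - s) mod L" for n
  have \<tau>_less: "\<tau> n < L" for n using L by (simp add: \<tau>_def)
  have \<tau>_s: "\<tau> s = 0" by (simp add: \<tau>_def)
  have \<tau>_Suc: "\<tau> (Suc n) = (if Suc (\<tau> n) = L then 0 else Suc (\<tau> n))" if "s \<le> n" for n
    using that by (simp add: \<tau>_def Suc_diff_le mod_Suc)
  have \<sigma>: "\<sigma> n = w ! \<tau> n" if "s \<le> n" for n
    using per[of "n - s"] that by (simp add: \<tau>_def L_def)
  define A where "A n = (\<Union>j\<in>S. set_pmf (word_kernel P (take (\<tau> n) w) j))" for n
  \<comment> \<open>surplus over \<open>c\<close> per step expected in the rest of the current block; \<open>u\<close> restarts at \<open>0\<close>\<close>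
  define v where "v t x = word_reward P g (drop t w) x - c * real (L - t)" for t x
  define u where "u n x = (if \<tau> n = 0 then 0 else v (\<tau> n) x)" for n x
  have AS: "A n = S" if "\<tau> n = 0" for n by (simp add: A_def that)
  have "AE \<omega> in M. \<omega> s \<in> A s \<longrightarrow> ereal c \<le> liminf (\<lambda>n. ereal ((\<Sum>i<n. g (\<omega> i) (\<sigma> i)) / real n))"
  proof (rule AE_average_ge_of_drift[where u = u and D = "real L + \<bar>c\<bar> * real L"])
    fix n x
    show "0 \<le> g x (\<sigma> n)" "g x (\<sigma> n) \<le> 1" by (rule g)+
    show "\<bar>u n x\<bar> \<le> real L + \<bar>c\<bar> * real L"
    proof -
      have "0 \<le> word_reward P g (drop (\<tau> n) w) x" by (rule word_reward_nonneg) (fact g)+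
      moreover have "word_reward P g (drop (\<tau> n) w) x \<le> real (length (drop (\<tau> n) w))"
        by (rule word_reward_le_length) (fact g)+
      moreover have "\<bar>c * real (L - \<tau> n)\<bar> \<le> \<bar>c\<bar> * real L"
        unfolding abs_mult by (intro mult_left_mono) auto
      ultimately show ?thesis by (auto simp: u_def v_def L_def)
    qed
    assume n: "s \<le> n" and x: "x \<in> A n"
    have tk: "take (Suc (\<tau> n)) w = take (\<tau> n) w @ [w ! \<tau> n]"
      using \<tau>_less[of n] by (simp add: take_Suc_conv_app_nth L_def)
    have dr: "drop (\<tau> n) w = w ! \<tau> n # drop (Suc (\<tau> n)) w"
      using \<tau>_less[of n] by (simp add: Cons_nth_drop_Suc L_def)
    have sub: "set_pmf (Q n x) \<subseteq> (\<Union>j\<in>S. set_pmf (word_kernel P (take (Suc (\<tau> n)) w) j))"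
      using x unfolding tk by (auto simp: A_def word_kernel_append word_kernel_single Q \<sigma>[OF n])
    show "set_pmf (Q n x) \<subseteq> A (Suc n)"
    proof (cases "Suc (\<tau> n) = L")
      case True
      then have "A (Suc n) = S" using \<tau>_Suc[OF n] by (intro AS) simp
      moreover have "take (Suc (\<tau> n)) w = w" using True by (simp add: L_def)
      ultimately show ?thesis using sub S by fastforce
    next
      case False
      then show ?thesis using sub \<tau>_Suc[OF n] by (simp add: A_def)
    qed
    \<comment> \<open>At the end of a block both sides vanish: the potential is reset and no letters
      remain in \<open>v L\<close>.\<close>
    have uS: "u (Suc n) = v (Suc (\<tau> n))"
      using \<tau>_Suc[OF n] by (auto simp: u_def v_def fun_eq_iff L_def)
    have "g x (\<sigma> n) + measure_pmf.expectation (Q n x) (u (Suc n))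
        = word_reward P g (drop (\<tau> n) w) x - c * real (L - Suc (\<tau> n))"
      by (simp add: uS v_def[abs_def] dr \<sigma>[OF n] Q)
    also have "c * real (L - Suc (\<tau> n)) = c * real (L - \<tau> n) - c"
      using \<tau>_less[of n] by (simp add: of_nat_diff algebra_simps)
    finally have eq: "g x (\<sigma> n) + measure_pmf.expectation (Q n x) (u (Suc n)) = v (\<tau> n) x + c"
      by (simp add: v_def)
    \<comment> \<open>The reset costs nothing: at a block start the state lies in \<open>S\<close>,
      where \<open>c\<close> makes the surplus of a full block nonnegative.\<close>
    have "u n x \<le> v (\<tau> n) x"
    proof (cases "\<tau> n = 0")
      case True
      then have "x \<in> S" using AS x by simp
      with c[of x] True show ?thesis by (simp add: u_def v_def L_def)
    qed (simp add: u_def)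
    then show "c + u n x \<le> g x (\<sigma> n) + measure_pmf.expectation (Q n x) (u (Suc n))"
      using eq by simp
  qed
  then show ?thesis
  proof eventually_elim
    case (elim \<omega>)
    show ?case
    proof
      assume "\<omega> s \<in> S"
      then have "ereal c \<le> liminf (\<lambda>n. ereal ((\<Sum>i<n. g (\<omega> i) (\<sigma> i)) / real n))"
        using elim AS[OF \<tau>_s] by simp
      also have "\<dots> = ereal (lower_average (\<lambda>i k. g k (\<sigma> i)) \<omega>)"
        using ereal_lower_average[of "\<lambda>i k. g k (\<sigma> i)" \<omega>] g by simp
      finally show "c \<le> lower_average (\<lambda>i k. g k (\<sigma> i)) \<omega>" by simp
    qed
  qed
qed

lemma AE_seg_support:
  assumes Q: "Q = (\<lambda>i. P (\<sigma> i))"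
  shows "AE \<omega> in M. \<forall>m l. \<omega> (m + l) \<in> set_pmf (word_kernel P (seg \<sigma> m l) (\<omega> m))"
  using AE_transition
proof eventually_elim
  case (elim \<omega>)
  show ?case
  proof (intro allI)
    fix m l show "\<omega> (m + l) \<in> set_pmf (word_kernel P (seg \<sigma> m l) (\<omega> m))"
    proof (induction l)
      case (Suc l)
      then show ?case using elim by (auto simp: seg_Suc word_kernel_append word_kernel_single Q)
    qed simp
  qed
qed

end

section \<open>Reachable-set maps and their recurrence\<close>

definition spread :: "('a \<Rightarrow> 'k \<Rightarrow> 'k pmf) \<Rightarrow> ('k \<Rightarrow> 'k set) \<Rightarrow> 'a list \<Rightarrow> 'k \<Rightarrow> 'k set" where
  "spread P F w k = (\<Union>j\<in>F k. set_pmf (word_kernel P w j))"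

lemma spread_append: "spread P F (v @ w) = spread P (spread P F v) w"
  by (auto simp: spread_def word_kernel_append fun_eq_iff)

lemma spread_Nil [simp]: "spread P F [] = F"
  by (auto simp: spread_def fun_eq_iff)

text \<open>There are finitely many pairs of maps, so one chosen connecting word per pair gives a
  uniform bound. Unconnected pairs get an arbitrary word and do no harm.\<close>

lemma return_words_bounded:
  fixes P :: "'a \<Rightarrow> 'k::finite \<Rightarrow> 'k pmf"
  shows "\<exists>R. \<forall>F w. \<exists>v. length v \<le> R \<and> spread P F v = spread P F w"
proof -
  define h where "h = (\<lambda>(F, F'). SOME v. spread P F v = F')"
  let ?R = "Max ((\<lambda>x. length (h x)) ` UNIV)"
  show ?thesis
  proof (intro exI[of _ ?R] allI)
    fix F w
    let ?v = "h (F, spread P F w)"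
    have "spread P F ?v = spread P F w"
      unfolding h_def prod.case by (rule someI[of _ w]) simp
    moreover have "length ?v \<le> ?R" by (rule Max_ge) auto
    ultimately show "\<exists>v. length v \<le> ?R \<and> spread P F v = spread P F w" by blast
  qed
qed

text \<open>The set of maps reachable from \<open>F i\<close> shrinks with \<open>i\<close>, so it cannot change at every step.\<close>

lemma spread_recurrence:
  fixes P :: "'a \<Rightarrow> 'k::finite \<Rightarrow> 'k pmf" and F :: "nat \<Rightarrow> 'k \<Rightarrow> 'k set"
  assumes F: "\<And>i. \<exists>w. F (Suc i) = spread P (F i) w"
  shows "\<exists>i \<le> CARD('k \<Rightarrow> 'k set). \<exists>w. F i = spread P (F (Suc i)) w"
proof (rule ccontr)
  let ?M = "CARD('k \<Rightarrow> 'k set)"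
  let ?R = "\<lambda>i. range (spread P (F i))"
  assume "\<not> ?thesis"
  then have no: "F i \<notin> ?R (Suc i)" if "i \<le> ?M" for i using that by blast
  have less: "card (?R (Suc i)) < card (?R i)" if "i \<le> ?M" for i
  proof (rule psubset_card_mono)
    obtain w where "F (Suc i) = spread P (F i) w" using F by blast
    then have "?R (Suc i) \<subseteq> ?R i" by (auto simp: spread_append[symmetric])
    moreover have "F i \<in> ?R i" by (rule range_eqI[of _ _ "[]"]) simp
    ultimately show "?R (Suc i) \<subset> ?R i" using no[OF that] by blast
  qed simp
  \<comment> \<open>The cardinality starts at most at \<open>?M\<close> and would drop strictly at
    each of the indices \<open>0\<close> to \<open>?M\<close>, which is one drop too many.\<close>
  have "card (?R i) + i \<le> ?M" if "i \<le> Suc ?M" for i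
    using that
  proof (induction i)
    case 0
    show ?case by (simp add: card_mono)
  next
    case (Suc i)
    then show ?case using less[of i] by simp
  qed
  from this[of "Suc ?M"] show False by simp
qed

section \<open>Choosing the period\<close>

text \<open>Greedy covering from the left: a bad stage is skipped at cost at most 1, a good stage
  starts a window with average at most \<open>c\<close>. The extra \<open>L\<close> pays for a last
  window that overshoots \<open>N\<close>.\<close>

lemma sum_le_tiling:
  fixes r :: "nat \<Rightarrow> real" and Bad :: "nat set"
  assumes r: "\<And>m. 0 \<le> r m" "\<And>m. r m \<le> 1" and c: "0 \<le> c"
    and tile: "\<And>m. m \<notin> Bad \<Longrightarrow> \<exists>n. 1 \<le> n \<and> n \<le> L \<and> (\<Sum>i=m..<m+n. r i) \<le> c * real n"
  shows "(\<Sum>i=s..<N. r i) \<le> c * real (N - s) + real (card (Bad \<inter> {s..<N})) + real L"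
proof (induction "N - s" arbitrary: s rule: less_induct)
  case less
  show ?case
  proof (cases "N \<le> s")
    case True
    then show ?thesis by simp
  next
    case False
    show ?thesis
    proof (cases "s \<in> Bad")
      case True
      have "(\<Sum>i=s..<N. r i) = r s + (\<Sum>i=Suc s..<N. r i)"
        using False by (simp add: sum.atLeast_Suc_lessThan)
      also have "\<dots> \<le> 1 + (c * real (N - Suc s) + real (card (Bad \<inter> {Suc s..<N})) + real L)"
        using False by (intro add_mono r(2) less) auto
      also have "Bad \<inter> {s..<N} = insert s (Bad \<inter> {Suc s..<N})"
        using True False by auto
      then have "1 + real (card (Bad \<inter> {Suc s..<N})) = real (card (Bad \<inter> {s..<N}))" by simp
      moreover have "c * real (N - Suc s) \<le> c * real (N - s)"
        using c by (intro mult_left_mono) auto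
      ultimately show ?thesis by simp
    next
      case good: False
      from tile[OF this] obtain n where n: "1 \<le> n" "n \<le> L" "(\<Sum>i=s..<s+n. r i) \<le> c * real n" by blast
      show ?thesis
      proof (cases "s + n \<le> N")
        case True
        have "(\<Sum>i=s..<N. r i) = (\<Sum>i=s..<s+n. r i) + (\<Sum>i=s+n..<N. r i)"
          using True by (simp add: sum.atLeastLessThan_concat)
        also have "\<dots> \<le> c * real n + (c * real (N - (s + n)) + real (card (Bad \<inter> {s+n..<N})) + real L)"
          using n False by (intro add_mono n(3) less) auto
        also have "card (Bad \<inter> {s+n..<N}) \<le> card (Bad \<inter> {s..<N})"
          by (intro card_mono) auto
        also have "c * real n + (c * real (N - (s + n)) + real (card (Bad \<inter> {s..<N})) + real L)
          = c * real (N - s) + real (card (Bad \<inter> {s..<N})) + real L"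
          using True by (simp add: of_nat_diff algebra_simps)
        finally show ?thesis by simp
      next
        case nle: False
        have "(\<Sum>i=s..<N. r i) \<le> (\<Sum>i=s..<N. 1)" by (intro sum_mono r)
        also have "\<dots> = real (N - s)" by simp
        also have "\<dots> \<le> real L" using nle n False by simp
        finally show ?thesis using c by (simp add: add_increasing)
      qed
    qed
  qed
qed

text \<open>If no stage worked, every stage outside \<open>Bad\<close> would start a window of
  average at most \<open>c\<close>. Bad stages have density at most \<open>e\<close>, since the
  \<open>I + 1\<close> scales together contribute \<open>e\<^sup>2\<close> per stage and each bad
  stage counts at least \<open>e\<close>. Tiling then caps the average at \<open>c + e\<close>,
  against \<open>avg\<close>.\<close>

lemma stable_stage_exists:
  fixes P :: "'a \<Rightarrow> 'k::finite \<Rightarrow> 'k pmf" and I :: nat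
  defines "b \<equiv> \<lambda>p \<sigma>. belief p (\<lambda>i. P (\<sigma> i))"
  assumes g: "\<And>k a. 0 \<le> g k a" "\<And>k a. g k a \<le> 1"
    and e: "0 < e" and c: "0 \<le> c"
    and avg: "\<And>K. \<exists>N. (c + e) * real N + K < (\<Sum>i<N. measure_pmf.expectation (b p \<sigma> i) (\<lambda>k. g k (\<sigma> i)))"
    and ns: "\<And>i. i \<le> I \<Longrightarrow> 1 \<le> ns i"
    and small: "\<And>i N. i \<le> I \<Longrightarrow> (\<Sum>m<N. measure (b p \<sigma> m) (unstable P g \<sigma> e (ls i) (ns i) m))
                  \<le> K i + e\<^sup>2 / real (Suc I) * real N"
  shows "\<exists>m. \<forall>i\<le>I. measure (b p \<sigma> m) (unstable P g \<sigma> e (ls i) (ns i) m) \<le> e \<and>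
    c * real (ns i) < measure_pmf.expectation (b p \<sigma> m) (word_reward P g (seg \<sigma> m (ns i)))"
proof (rule ccontr)
  assume neg: "\<not> ?thesis"
  define r where "r i = measure_pmf.expectation (b p \<sigma> i) (\<lambda>k. g k (\<sigma> i))" for i
  define \<beta> where "\<beta> i m = measure (b p \<sigma> m) (unstable P g \<sigma> e (ls i) (ns i) m)" for i m
  define Bad where "Bad = {m. \<exists>i\<le>I. e < \<beta> i m}"
  define L where "L = Max (ns ` {..I})"
  have r0: "0 \<le> r m" for m by (simp add: r_def g)
  have r1: "r m \<le> 1" for m
  proof -
    have "r m \<le> measure_pmf.expectation (b p \<sigma> m) (\<lambda>_. 1)"
      unfolding r_def by (intro integral_mono) (auto simp: g)
    then show ?thesis by simp
  qed
  have tile: "\<exists>n. 1 \<le> n \<and> n \<le> L \<and> (\<Sum>i=m..<m+n. r i) \<le> c * real n" if "m \<notin> Bad" for m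
  proof -
    from neg obtain i where i: "i \<le> I" "\<beta> i m \<le> e \<longrightarrow>
      measure_pmf.expectation (b p \<sigma> m) (word_reward P g (seg \<sigma> m (ns i))) \<le> c * real (ns i)"
      unfolding \<beta>_def by (metis not_less)
    with that have i: "i \<le> I"
      "measure_pmf.expectation (b p \<sigma> m) (word_reward P g (seg \<sigma> m (ns i))) \<le> c * real (ns i)"
      by (auto simp: Bad_def not_less)
    have "ns i \<le> L" unfolding L_def using i(1) by (intro Max_ge) auto
    with i ns[OF i(1)] show ?thesis
      by (intro exI[of _ "ns i"]) (simp add: r_def b_def sum_belief_reward)
  qed
  have bad: "real (card (Bad \<inter> {0..<N})) \<le> (\<Sum>i\<le>I. K i) / e + e * real N" for N
  proof -
    have "e * real (card (Bad \<inter> {0..<N})) = (\<Sum>m\<in>Bad \<inter> {0..<N}. e)" by simp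
    also have "\<dots> \<le> (\<Sum>m\<in>Bad \<inter> {0..<N}. \<Sum>i\<le>I. \<beta> i m)"
    proof (rule sum_mono)
      fix m assume "m \<in> Bad \<inter> {0..<N}"
      then obtain i where i: "i \<le> I" "e < \<beta> i m" by (auto simp: Bad_def)
      have "\<beta> i m \<le> (\<Sum>i\<le>I. \<beta> i m)"
        using i by (intro member_le_sum) (auto simp: \<beta>_def)
      with i show "e \<le> (\<Sum>i\<le>I. \<beta> i m)" by simp
    qed
    also have "\<dots> \<le> (\<Sum>m<N. \<Sum>i\<le>I. \<beta> i m)"
      by (intro sum_mono2) (auto simp: \<beta>_def sum_nonneg)
    also have "\<dots> = (\<Sum>i\<le>I. \<Sum>m<N. \<beta> i m)" by (rule sum.swap)
    also have "\<dots> \<le> (\<Sum>i\<le>I. K i + e\<^sup>2 / real (Suc I) * real N)"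
      unfolding \<beta>_def by (intro sum_mono small) simp
    also have "\<dots> = (\<Sum>i\<le>I. K i) + e\<^sup>2 * real N" by (simp add: sum.distrib)
    finally show ?thesis using e by (simp add: field_simps power2_eq_square)
  qed
  obtain N where N: "(c + e) * real N + ((\<Sum>i\<le>I. K i) / e + real L) < (\<Sum>i<N. r i)"
    using avg[of "(\<Sum>i\<le>I. K i) / e + real L"] unfolding r_def by blast
  have "(\<Sum>i=0..<N. r i) \<le> c * real (N - 0) + real (card (Bad \<inter> {0..<N})) + real L"
    by (rule sum_le_tiling[OF r0 r1 c tile])
  with bad[of N] have "(\<Sum>i<N. r i) \<le> (c + e) * real N + ((\<Sum>i\<le>I. K i) / e + real L)"
    by (simp add: atLeast0LessThan algebra_simps)
  with N show False by simp
qed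

text \<open>Given \<open>l\<close>, first \<open>\<eta>\<close> is fixed, then \<open>n\<close> is
  taken large relative to \<open>l / \<eta>\<close>, so that the unstable mass per stage is at most
  \<open>x\<close>; the part independent of \<open>N\<close> goes into \<open>K\<close>. Taking
  \<open>n\<close> beyond \<open>R / e\<close> makes return words short relative to the
  window.\<close>

lemma scales_exist:
  fixes P :: "'a::finite \<Rightarrow> 'k::finite \<Rightarrow> 'k pmf"
  assumes g: "\<And>k a. 0 \<le> g k a" "\<And>k a. g k a \<le> 1" and e: "0 < e" and x: "0 < x"
  shows "\<exists>ls ns K. (\<forall>i. ls (Suc i) = ls i + ns i \<and> 1 \<le> ns i \<and> R \<le> e * real (ns i) \<and>
    (\<forall>N. (\<Sum>m<N. measure (belief p (\<lambda>i. P (\<sigma> i)) m) (unstable P g \<sigma> e (ls i) (ns i) m)) \<le> K i + x * real N))"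
proof -
  let ?S = "\<lambda>l n N. \<Sum>m<N. measure (belief p (\<lambda>i. P (\<sigma> i)) m) (unstable P g \<sigma> e l n m)"
  have "\<exists>n K. 1 \<le> n \<and> R \<le> e * real n \<and> (\<forall>N. ?S l n N \<le> K + x * real N)" for l :: nat
  proof -
    obtain \<eta> where \<eta>: "0 < \<eta>" "\<And>w k j. length w = l \<Longrightarrow> j \<in> set_pmf (word_kernel P w k) \<Longrightarrow> \<eta> \<le> pmf (word_kernel P w k) j"
      using word_kernel_prob_lower_bound[of l P] by blast
    obtain n where n: "1 + max (R / e) (2 * real l / (\<eta> * e\<^sup>2 * x)) < real n"
      using reals_Archimedean2 by blast
    have n1: "1 < real n" "R / e < real n" "2 * real l / (\<eta> * e\<^sup>2 * x) < real n"
    proof -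
      have "0 \<le> 2 * real l / (\<eta> * e\<^sup>2 * x)" using \<eta> e x by simp
      then show "1 < real n" "R / e < real n" "2 * real l / (\<eta> * e\<^sup>2 * x) < real n" using n by linarith+
    qed
    then have n': "1 \<le> n" by simp
    have "2 * real l / (real n * \<eta> * e\<^sup>2) \<le> x"
      using n1(1,3) \<eta>(1) e x by (simp add: field_simps)
    then have "?S l n N \<le> real l / (\<eta> * e\<^sup>2) + x * real N" for N
      using sum_prob_unstable_le[where g = g and P = P and l = l and n = n and e = e and \<eta> = \<eta> and p = p and \<sigma> = \<sigma> and N = N,
          OF g \<eta> e n'] mult_right_mono[of _ x "real N"] by (meson add_left_mono of_nat_0_le_iff order_trans)
    moreover have "R \<le> e * real n" using n1(2) e by (simp add: field_simps)
    ultimately show ?thesis using n' by blast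
  qed
  then obtain nn KK where nn: "\<And>l. 1 \<le> nn l" "\<And>l. R \<le> e * real (nn l)"
    "\<And>l N. ?S l (nn l) N \<le> KK l + x * real N" by metis
  define ls where "ls = rec_nat 0 (\<lambda>_ l. l + nn l)"
  show ?thesis
    by (rule exI[of _ ls], rule exI[of _ "\<lambda>i. nn (ls i)"], rule exI[of _ "\<lambda>i. KK (ls i)"])
       (use nn in \<open>simp add: ls_def\<close>)
qed

section \<open>Assembly of the periodic sequence\<close>

lemma payoff_inf_eq_lower_average:
  "payoff_inf p1 q g \<sigma> = (\<integral>\<omega>. lower_average (\<lambda>i k. g k (\<sigma> i)) \<omega> \<partial>play_law p1 q \<sigma>)"
  by (simp add: payoff_inf_def lower_average_def)

lemma belief_cong: "(\<And>i. i < n \<Longrightarrow> Q i = Q' i) \<Longrightarrow> belief p Q n = belief p Q' n"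
  by (induction n) auto

text \<open>Of the loss \<open>6 * e\<close>, the threshold \<open>c\<close> takes
  \<open>3 * e\<close>, each stable state loses \<open>2 * e\<close> to instability and to the
  return word, and the unstable states cost a final \<open>e\<close>. The hypothesis
  \<open>pos\<close> makes \<open>c\<close> nonnegative, as the tiling requires.\<close>

lemma eventually_periodic_approximation:
  fixes q :: "'k::finite \<Rightarrow> 'a::finite \<Rightarrow> ('k \<times> 's) pmf" and g :: "'k \<Rightarrow> 'a \<Rightarrow> real"
  assumes g: "\<And>k a. 0 \<le> g k a" "\<And>k a. g k a \<le> 1" and e: "0 < e"
    and pos: "3 * e \<le> payoff_inf p1 q g \<sigma>"
  shows "\<exists>\<sigma>'. payoff_inf p1 q g \<sigma> - 6 * e \<le> payoff_inf p1 q g \<sigma>' \<and> eventually_periodic \<sigma>'"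
proof -
  define P where "P a k = map_pmf fst (q k a)" for a k
  define G where "G = payoff_inf p1 q g \<sigma>"
  define c where "c = G - 3 * e"
  have c: "0 \<le> c" using pos by (simp add: c_def G_def)
  define b where "b = belief p1 (\<lambda>i. P (\<sigma> i))"
  have chain: "markov_chain (play_law p1 q \<sigma>) p1 (\<lambda>i. P (\<sigma> i))" for \<sigma>
    using play_law_markov_chain[of p1 q \<sigma>] by (simp add: P_def[abs_def])
  have avg: "\<exists>N. (c + e) * real N + K < (\<Sum>i<N. measure_pmf.expectation (b i) (\<lambda>k. g k (\<sigma> i)))" for K
  proof -
    interpret markov_chain "play_law p1 q \<sigma>" p1 "\<lambda>i. P (\<sigma> i)" by (rule chain)
    have "\<forall>\<^sub>F n in sequentially. (G - e) * real n \<le> (\<Sum>i<n. measure_pmf.expectation (b i) (\<lambda>k. g k (\<sigma> i)))"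
      using eventually_sum_belief_ge[of "\<lambda>i k. g k (\<sigma> i)" e] g e
      by (simp add: G_def payoff_inf_eq_lower_average b_def)
    moreover have "\<forall>\<^sub>F n in sequentially. K / e < real n"
      by (rule filterlim_at_top_dense[THEN iffD1, rule_format, OF filterlim_real_sequentially])
    ultimately have "\<forall>\<^sub>F n in sequentially. (c + e) * real n + K < (\<Sum>i<n. measure_pmf.expectation (b i) (\<lambda>k. g k (\<sigma> i)))"
    proof eventually_elim
      case (elim n)
      have "K < e * real n" using elim(2) e by (simp add: field_simps)
      with elim(1) show ?case by (simp add: c_def algebra_simps)
    qed
    then show ?thesis by (rule eventually_happens'[OF sequentially_bot])
  qed
  obtain R where R: "\<And>F w. \<exists>v. length v \<le> R \<and> spread P F v = spread P F w"
    using return_words_bounded[of P] by blast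
  let ?I = "CARD('k \<Rightarrow> 'k set)"
  have "0 < e\<^sup>2 / real (Suc ?I)" using e by simp
  from scales_exist[where g = g and P = P and R = "real R" and p = p1 and \<sigma> = \<sigma>, OF g e this]
  obtain ls ns K where scales: "\<forall>i. ls (Suc i) = ls i + ns i \<and> 1 \<le> ns i \<and> real R \<le> e * real (ns i) \<and>
    (\<forall>N. (\<Sum>m<N. measure (b m) (unstable P g \<sigma> e (ls i) (ns i) m)) \<le> K i + e\<^sup>2 / real (Suc ?I) * real N)"
    unfolding b_def by blast
  then have ls: "ls (Suc i) = ls i + ns i" and ns: "1 \<le> ns i" and Rn: "real R \<le> e * real (ns i)"
    and small: "(\<Sum>m<N. measure (b m) (unstable P g \<sigma> e (ls i) (ns i) m)) \<le> K i + e\<^sup>2 / real (Suc ?I) * real N"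
    for i N by blast+
  obtain m where m: "\<And>i. i \<le> ?I \<Longrightarrow> measure (b m) (unstable P g \<sigma> e (ls i) (ns i) m) \<le> e"
    "\<And>i. i \<le> ?I \<Longrightarrow> c * real (ns i) < measure_pmf.expectation (b m) (word_reward P g (seg \<sigma> m (ns i)))"
    using stable_stage_exists[where P = P and g = g and p = p1 and \<sigma> = \<sigma> and I = ?I
        and ns = ns and ls = ls and K = K, folded b_def, OF g e c avg ns small] by blast
  \<comment> \<open>The reachable sets are kept separately for each state \<open>k\<close> at stage
    \<open>m\<close>, because the guaranteed average \<open>h k\<close> depends on
    \<open>k\<close>.\<close>
  define F where "F i k = set_pmf (word_kernel P (seg \<sigma> m (ls i)) k)" for i k
  have F_Suc: "F (Suc i) = spread P (F i) (seg \<sigma> (m + ls i) (ns i))" for i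
    by (auto simp: F_def spread_def ls seg_add word_kernel_append fun_eq_iff)
  from spread_recurrence[of F P] F_Suc obtain i u where i: "i \<le> ?I" and u: "F i = spread P (F (Suc i)) u"
    by blast
  from R[of "F (Suc i)" u] u obtain v where v: "length v \<le> R" "spread P (F (Suc i)) v = F i" by auto
  define l n s where "l = ls i" and "n = ns i" and "s = m + l"
  define w where "w = seg \<sigma> s n @ v"
  define \<sigma>' where "\<sigma>' j = (if j < s then \<sigma> j else w ! ((j - s) mod length w))" for j
  have n: "1 \<le> n" unfolding n_def by (rule ns)
  have w: "w \<noteq> []" using n by (auto simp: w_def simp flip: length_0_conv)
  \<comment> \<open>The window of length \<open>n\<close> takes \<open>F i\<close> to
    \<open>F (Suc i)\<close>, and \<open>v\<close> brings it back.\<close>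
  have closed: "spread P (F i) w = F i"
    unfolding w_def spread_append using v(2) F_Suc[of i] by (simp add: s_def l_def n_def)
  have per: "eventually_periodic \<sigma>'"
    unfolding eventually_periodic_def
  proof (intro exI conjI allI impI)
    show "1 \<le> length w" using w by (simp add: Suc_le_eq)
    fix j assume "s \<le> j"
    then have "(j + length w - s) mod length w = (j - s) mod length w"
      by (metis Nat.add_diff_assoc2 mod_add_self2)
    then show "\<sigma>' (j + length w) = \<sigma>' j" using \<open>s \<le> j\<close> by (simp add: \<sigma>'_def)
  qed
  define X where "X k = word_reward P g (seg \<sigma> m n) k / real n" for k
  define U where "U = unstable P g \<sigma> e l n m"
  \<comment> \<open>The value \<open>0\<close> on \<open>U\<close> is the trivial bound. Elsewhere
    one \<open>e\<close> covers the drop in outlook after \<open>l\<close> steps and the other the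
    stages of \<open>v\<close>, which may earn nothing.\<close>
  define h where "h k = (if k \<in> U then 0 else X k - 2 * e)" for k
  have X01: "0 \<le> X k" "X k \<le> 1" for k
    using word_reward_nonneg[of g P "seg \<sigma> m n" k] word_reward_le_length[of g P "seg \<sigma> m n" k] g n
    by (auto simp: X_def divide_le_eq)
  have block: "h k * real (length w) \<le> word_reward P g w j" if k: "k \<notin> U" and j: "j \<in> F i k" for k j
  proof -
    have "word_reward P g (seg \<sigma> m n) k - e * real n \<le> word_reward P g (seg \<sigma> s n) j"
      using k j by (auto simp: U_def unstable_def F_def l_def s_def not_less)
    also have "\<dots> \<le> word_reward P g w j"
      by (simp add: w_def word_reward_append word_reward_nonneg g)
    finally have 1: "(X k - e) * real n \<le> word_reward P g w j" using n by (simp add: X_def left_diff_distrib)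
    have "real (length v) \<le> e * real n" using v(1) Rn[of i] by (simp add: n_def)
    moreover have "(X k - 2 * e) * real (length v) \<le> 1 * real (length v)"
      using X01[of k] e by (intro mult_right_mono) auto
    ultimately have "(X k - 2 * e) * real (length w) \<le> (X k - e) * real n"
      by (simp add: w_def algebra_simps)
    with 1 show ?thesis using k by (simp add: h_def)
  qed
  interpret N: markov_chain "play_law p1 q \<sigma>'" p1 "\<lambda>i. P (\<sigma>' i)" by (rule chain)
  have g': "\<And>n x. 0 \<le> g x (\<sigma>' n)" "\<And>n x. g x (\<sigma>' n) \<le> 1" by (rule g)+
  have seg': "seg \<sigma>' m l = seg \<sigma> m l" by (auto simp: seg_def \<sigma>'_def s_def)
  \<comment> \<open>The null set must not depend on \<open>k\<close>, since \<open>k\<close> is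
    afterwards replaced by the random state \<open>\<omega> m\<close>.\<close>
  have "AE \<omega> in play_law p1 q \<sigma>'. \<forall>k. k \<notin> U \<longrightarrow> \<omega> s \<in> F i k \<longrightarrow> h k \<le> lower_average (\<lambda>i k. g k (\<sigma>' i)) \<omega>"
  proof (subst AE_all_countable, intro allI)
    fix k
    show "AE \<omega> in play_law p1 q \<sigma>'. k \<notin> U \<longrightarrow> \<omega> s \<in> F i k \<longrightarrow> h k \<le> lower_average (\<lambda>i k. g k (\<sigma>' i)) \<omega>"
    proof (cases "k \<in> U")
      case False
      have "AE \<omega> in play_law p1 q \<sigma>'. \<omega> s \<in> F i k \<longrightarrow> h k \<le> lower_average (\<lambda>i k. g k (\<sigma>' i)) \<omega>"
      proof (rule N.AE_periodic_average_ge[where P = P, OF refl g w])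
        show "\<sigma>' (s + t) = w ! (t mod length w)" for t by (simp add: \<sigma>'_def)
        show "set_pmf (word_kernel P w j) \<subseteq> F i k" if "j \<in> F i k" for j
          using fun_cong[OF closed, of k] that by (auto simp: spread_def)
        show "h k * real (length w) \<le> word_reward P g w j" if "j \<in> F i k" for j
          by (rule block[OF False that])
      qed
      then show ?thesis by eventually_elim simp
    qed simp
  qed
  with N.AE_seg_support[where P = P, OF refl]
  have ae: "AE \<omega> in play_law p1 q \<sigma>'. h (\<omega> m) \<le> lower_average (\<lambda>i k. g k (\<sigma>' i)) \<omega>"
  proof eventually_elim
    case (elim \<omega>)
    have "\<omega> s \<in> F i (\<omega> m)"
      using elim(1)[rule_format, of m l] seg' by (simp add: F_def s_def l_def)
    then show ?case
      using elim(2) lower_average_nonneg[of "\<lambda>i k. g k (\<sigma>' i)" \<omega>] g by (cases "\<omega> m \<in> U") (auto simp: h_def)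
  qed
  have "G - 6 * e \<le> measure_pmf.expectation (b m) h"
  proof -
    have "c * real n < measure_pmf.expectation (b m) (word_reward P g (seg \<sigma> m n))"
      using m(2)[OF i] by (simp add: n_def)
    then have "c < measure_pmf.expectation (b m) X"
      using n by (simp add: X_def[abs_def] pos_less_divide_eq)
    \<comment> \<open>On \<open>U\<close>, where \<open>h\<close> is \<open>0\<close>, the indicator
      suffices because \<open>X\<close> is at most 1.\<close>
    also have "\<dots> \<le> measure_pmf.expectation (b m) (\<lambda>k. h k + 2 * e + indicator U k)"
      using X01 e by (intro integral_mono) (auto simp: h_def indicator_def add_increasing)
    also have "\<dots> = measure_pmf.expectation (b m) h + 2 * e + measure (b m) U" by simp
    finally show ?thesis using m(1)[OF i] by (simp add: c_def U_def l_def n_def)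
  qed
  also have "b m = belief p1 (\<lambda>i. P (\<sigma>' i)) m"
    unfolding b_def by (rule belief_cong) (simp add: \<sigma>'_def s_def)
  also have "measure_pmf.expectation \<dots> h = (\<integral>\<omega>. h (\<omega> m) \<partial>play_law p1 q \<sigma>')"
    by (rule N.integral_coordinate[symmetric])
  also have "\<dots> \<le> payoff_inf p1 q g \<sigma>'"
    unfolding payoff_inf_eq_lower_average
    by (intro integral_mono_AE N.coordinate_integrable N.lower_average_integrable ae g')
  finally show ?thesis using per unfolding G_def by blast
qed

theorem theorem2:
  fixes q :: "'k::finite \<Rightarrow> 'a::finite \<Rightarrow> ('k \<times> 's::finite) pmf"
    and g :: "'k \<Rightarrow> 'a \<Rightarrow> real" and p1 :: "'k pmf" and \<epsilon> :: real
  assumes "blind_MDP q g" and "\<epsilon> > 0"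
  shows "\<exists>\<sigma>. payoff_inf p1 q g \<sigma> \<ge> value_inf p1 q g - \<epsilon> \<and> eventually_periodic \<sigma>"
proof -
  have g: "\<And>k a. 0 \<le> g k a" "\<And>k a. g k a \<le> 1"
    using assms(1) by (auto simp: blind_MDP_def)
  have bound: "payoff_inf p1 q g \<sigma> \<le> 1" for \<sigma>
  proof -
    interpret markov_chain "play_law p1 q \<sigma>" p1 "\<lambda>i k. map_pmf fst (q k (\<sigma> i))"
      by (rule play_law_markov_chain)
    show ?thesis unfolding payoff_inf_eq_lower_average by (rule integral_lower_average_le_1) (rule g)+
  qed
  then have "bdd_above (range (payoff_inf p1 q g))" by (auto intro!: bdd_aboveI)
  then obtain \<sigma> where \<sigma>: "value_inf p1 q g - \<epsilon> / 2 < payoff_inf p1 q g \<sigma>"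
    using less_cSUP_iff[of UNIV "payoff_inf p1 q g" "value_inf p1 q g - \<epsilon> / 2"] assms(2)
    by (auto simp: value_inf_def)
  show ?thesis
  \<comment> \<open>With \<open>e = \<epsilon> / 12\<close> the approximation loses
    \<open>\<epsilon> / 2\<close>, on top of the \<open>\<epsilon> / 2\<close> lost in choosing
    \<open>\<sigma>\<close>. If the payoff is below \<open>\<epsilon> / 4\<close>, the value is
    below \<open>\<epsilon>\<close> and any constant sequence will do.\<close>
  proof (cases "3 * (\<epsilon> / 12) \<le> payoff_inf p1 q g \<sigma>")
    case True
    with eventually_periodic_approximation[where g = g and q = q and e = "\<epsilon> / 12" and ?p1.0 = p1 and \<sigma> = \<sigma>] g assms(2)
    obtain \<sigma>' where "payoff_inf p1 q g \<sigma> - 6 * (\<epsilon> / 12) \<le> payoff_inf p1 q g \<sigma>'" "eventually_periodic \<sigma>'"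
      by auto
    then show ?thesis using \<sigma> by (intro exI[of _ \<sigma>']) auto
  next
    case False
    let ?\<sigma> = "\<lambda>_::nat. undefined :: 'a"
    have "0 \<le> payoff_inf p1 q g ?\<sigma>"
      unfolding payoff_inf_eq_lower_average
      by (rule Bochner_Integration.integral_nonneg, rule lower_average_nonneg) (rule g)+
    moreover have "eventually_periodic ?\<sigma>" by (auto simp: eventually_periodic_def)
    moreover have "value_inf p1 q g - \<epsilon> \<le> 0" using False \<sigma> assms(2) by simp
    ultimately show ?thesis by (intro exI[of _ ?\<sigma>]) auto
  qed
qed

end
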